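(* Let $q\ge 2$ be an integer and let $G$ be a graph (edge-weighted modulo $q$) of order $n\ge 1$. Suppose that for every vertex $v$ of $G$ the subgraph $G\setminus\{v\}$ is separable. Then either $G$ is separable, or $q$ is even, $n$ is odd, and $G$ is isomorphic to some switching of the graph $G_{n,\gamma}$ for some $\gamma\in\{0,\ldots,q-1\}$.
   Context: Fix an integer $q\ge 2$. A graph $G=(V,E)$ consists of a finite vertex set $V$ and a symmetric map $E:V^2\to\{0,1,\ldots,q-1\}$ with $E(v,v)=0$ for all $v\in V$; for distinct $v,w$, $E(v,w)$ is the weight of the edge $\{v,w\}$, weight $0$ meaning absence of an edge. The order of $G$ is $|V|$. For $W\subset V$, the subgraph $G_W$ is the graph on $W$ with the weights inherited from $G$; $G\setminus\{v\}$ denotes $G_{V\setminus\{v\}}$. Isomorphism of graphs means a bijection of vertex sets preserving weights. A vertex is isolated if all edges at it have weight $0$. The sum of two graphs on the same vertex set has, as the weight of each edge, the sum modulo $q$ of the weights of the corresponding edges. A graph is additive if its vertices can be labelled by numbers from $\{0,\ldots,q-1\}$ so that the weight of each edge (pair of distinct vertices) equals the sum modulo $q$ of the labels of its two vertices. A switching of $G$ is the sum of $G$ with some additive graph on the same vertex set. A set $W\subset V$ is separable in $G$ (a separable set) if some switching of $G$ has no edges (of nonzero weight) between $W$ and $V\setminus W$. Every vertex set of cardinality $0,1,|V|-1$ or $|V|$ is separable; all other separable sets are called nontrivial. The graph $G$ is called separable (switching separable) if it has a nontrivial separable set of vertices. For $q$ even, $n=2k+1\ge 5$ and $\gamma\in\{0,\ldots,q-1\}$,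 the graph $G_{n,\gamma}$ has vertex set $\{a_0,a_1,\ldots,a_k,b_1,\ldots,b_k\}$; the vertex $a_0$ is isolated; for $l,m\in\{1,\ldots,k\}$ the edge $\{a_l,b_m\}$ has weight $\gamma$ if $l<m$ and weight $\gamma+q/2 \pmod q$ if $l\ge m$; for distinct $l,m\in\{1,\ldots,k\}$ the edges $\{a_l,a_m\}$ and $\{b_l,b_m\}$ have weight $\gamma$. *)

theory Defs
  imports Main
begin

text \<open>Only the values of \<^term>\<open>wt\<close> on pairs of vertices are meaningful: every notion below
  reads weights on \<^term>\<open>verts\<close> only.  The residues modulo \<open>q\<close> are the naturals below \<open>q\<close>.\<close>

record 'v wgraph =
  verts :: "'v set"
  wt :: "'v \<Rightarrow> 'v \<Rightarrow> nat"

definition wgraph :: "nat \<Rightarrow> 'v wgraph \<Rightarrow> bool" where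
  "wgraph q G \<longleftrightarrow> finite (verts G) \<and>
     (\<forall>v\<in>verts G. \<forall>w\<in>verts G. wt G v w < q \<and> wt G v w = wt G w v) \<and>
     (\<forall>v\<in>verts G. wt G v v = 0)"

definition graph_order :: "'v wgraph \<Rightarrow> nat" where
  "graph_order G = card (verts G)"

definition subgraph_on :: "'v wgraph \<Rightarrow> 'v set \<Rightarrow> 'v wgraph" where
  "subgraph_on G W = \<lparr>verts = W, wt = wt G\<rparr>"

definition del_vertex :: "'v wgraph \<Rightarrow> 'v \<Rightarrow> 'v wgraph" where
  "del_vertex G v = subgraph_on G (verts G - {v})"

definition isomorphic :: "'v wgraph \<Rightarrow> 'w wgraph \<Rightarrow> bool" where
  "isomorphic G H \<longleftrightarrow> (\<exists>\<phi>. bij_betw \<phi> (verts G) (verts H) \<and>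
     (\<forall>v\<in>verts G. \<forall>w\<in>verts G. wt H (\<phi> v) (\<phi> w) = wt G v w))"

text \<open>Meant for two graphs with the same vertex set.\<close>

definition graph_sum :: "nat \<Rightarrow> 'v wgraph \<Rightarrow> 'v wgraph \<Rightarrow> 'v wgraph" where
  "graph_sum q G H = \<lparr>verts = verts G, wt = (\<lambda>v w. (wt G v w + wt H v w) mod q)\<rparr>"

definition additive :: "nat \<Rightarrow> 'v wgraph \<Rightarrow> bool" where
  "additive q A \<longleftrightarrow> wgraph q A \<and>
     (\<exists>f :: 'v \<Rightarrow> nat. (\<forall>v\<in>verts A. f v < q) \<and>
        (\<forall>v\<in>verts A. \<forall>w\<in>verts A. v \<noteq> w \<longrightarrow> wt A v w = (f v + f w) mod q))"

definition is_switching :: "nat \<Rightarrow> 'v wgraph \<Rightarrow> 'v wgraph \<Rightarrow> bool" where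
  "is_switching q H G \<longleftrightarrow>
     (\<exists>A. additive q A \<and> verts A = verts G \<and> H = graph_sum q G A)"

definition separable_set :: "nat \<Rightarrow> 'v wgraph \<Rightarrow> 'v set \<Rightarrow> bool" where
  "separable_set q G W \<longleftrightarrow> W \<subseteq> verts G \<and>
     (\<exists>H. is_switching q H G \<and> (\<forall>v\<in>W. \<forall>w\<in>verts G - W. wt H v w = 0))"

definition nontrivial_separable_set :: "nat \<Rightarrow> 'v wgraph \<Rightarrow> 'v set \<Rightarrow> bool" where
  "nontrivial_separable_set q G W \<longleftrightarrow> separable_set q G W \<and>
     card W \<notin> {0, 1, card (verts G) - 1, card (verts G)}"

definition separable :: "nat \<Rightarrow> 'v wgraph \<Rightarrow> bool" where
  "separable q G \<longleftrightarrow> (\<exists>W. nontrivial_separable_set q G W)"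

datatype ab_vertex = VA nat | VB nat

fun exceptional_wt :: "nat \<Rightarrow> nat \<Rightarrow> ab_vertex \<Rightarrow> ab_vertex \<Rightarrow> nat" where
  "exceptional_wt q \<gamma> (VA l) (VA m) = (if l = 0 \<or> m = 0 \<or> l = m then 0 else \<gamma>)"
| "exceptional_wt q \<gamma> (VB l) (VB m) = (if l = m then 0 else \<gamma>)"
| "exceptional_wt q \<gamma> (VA l) (VB m) =
     (if l = 0 then 0 else if l < m then \<gamma> else (\<gamma> + q div 2) mod q)"
| "exceptional_wt q \<gamma> (VB m) (VA l) =
     (if l = 0 then 0 else if l < m then \<gamma> else (\<gamma> + q div 2) mod q)"

text \<open>The graph \<open>G\<^bsub>n,\<gamma>\<^esub>\<close>, meant for even \<open>q\<close>, \<open>\<gamma> < q\<close> and odd \<open>n = 2 * k + 1 \<ge> 5\<close>,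
  so that \<open>n div 2 = k\<close>.\<close>

definition exceptional_graph :: "nat \<Rightarrow> nat \<Rightarrow> nat \<Rightarrow> ab_vertex wgraph" where
  "exceptional_graph q n \<gamma> =
     \<lparr>verts = VA ` {0..n div 2} \<union> VB ` {1..n div 2}, wt = exceptional_wt q \<gamma>\<rparr>"

end

theory Submission
  imports Defs
begin

text \<open>
  A set \<open>W\<close> is separable exactly if all second differences of the weights between \<open>W\<close> and its
  complement vanish modulo \<open>q\<close>.  This condition can be glued: if it holds between \<open>X\<close> and each of
  two intersecting sets, it holds between \<open>X\<close> and their union.  Hence crossing separations can be
  uncrossed, also when they belong to subgraphs with different deleted vertices.

  Let \<open>G\<close> be nonseparable with all \<open>G - v\<close> separable.  A smallest nontrivial separable set of any
  \<open>G - v\<close> is a pair \<open>{u, x}\<close> (lemma \<open>exists_twins\<close>).  Uncrossing separations of \<open>G - u\<close> and \<open>G - x\<close>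
  shows that these again come from pairs (\<open>twins_dichotomy\<close>), and, for at least six vertices, that
  they are unique.  The pairs therefore define a \<open>2\<close>-regular graph on some of the vertices, and
  a component of it is a cycle \<open>p 0, \<dots>, p (L - 1)\<close> of length at least five such that the two
  neighbours of each of its vertices \<open>p i\<close> form a separable set of \<open>G - p i\<close>
  (\<open>exists_twin_cycle\<close>; five vertices are treated by hand).

  Such a cycle determines the graph.  After a switching that isolates \<open>p 0\<close>, the vertices
  \<open>p (i - 1)\<close> and \<open>p (i + 1)\<close> have equal weights to everything outside \<open>{p (i - 1), p i, p (i + 1)}\<close>
  and different weights to \<open>p i\<close>, while \<open>p 2\<close> and \<open>p (L - 2)\<close> have constant weights.  Propagating
  along the path \<open>p 1, \<dots>, p (L - 1)\<close> from both ends excludes even \<open>L\<close> and vertices off the cycle,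
  and yields a half-graph with two weights \<open>\<gamma> \<noteq> \<delta>\<close> (\<open>half_graph_structure\<close>).  Finally, separability
  of the pair formed by the two ends of the path, in \<open>G - p 0\<close>, gives \<open>2 * (\<delta> - \<gamma>) = 0\<close> modulo \<open>q\<close>,
  so \<open>q\<close> is even and \<open>\<delta> = \<gamma> + q / 2\<close>: this is the exceptional graph.
\<close>

section \<open>Uncrossing splits\<close>

text \<open>The reading of \<open>S X Y\<close> is that some switching has no edges between \<open>X\<close> and \<open>Y\<close>.
  The combinatorial part of the argument uses nothing about weights beyond these closure
  properties, of which gluing is what makes uncrossing possible.\<close>

locale split_relation =
  fixes V :: "'v set" and S :: "'v set \<Rightarrow> 'v set \<Rightarrow> bool"
  assumes finite_V: "finite V"
    and S_sym: "S X Y \<Longrightarrow> S Y X"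
    and S_mono: "S X Y \<Longrightarrow> X' \<subseteq> X \<Longrightarrow> Y' \<subseteq> Y \<Longrightarrow> S X' Y'"
    and S_glue: "S X B \<Longrightarrow> S X D \<Longrightarrow> B \<inter> D \<noteq> {} \<Longrightarrow> S X (B \<union> D)"
begin

definition split :: "'v \<Rightarrow> 'v set \<Rightarrow> 'v set \<Rightarrow> bool" where
  "split v A B \<longleftrightarrow> v \<in> V \<and> A \<union> B = V - {v} \<and> A \<inter> B = {} \<and> 2 \<le> card A \<and> 2 \<le> card B \<and> S A B"

text \<open>The name refers to the switching that isolates some fourth vertex: there \<open>u\<close> and \<open>x\<close>
  have the same weights to every vertex outside \<open>{v, u, x}\<close>.\<close>

definition twins :: "'v \<Rightarrow> 'v \<Rightarrow> 'v \<Rightarrow> bool" where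
  "twins v u x \<longleftrightarrow> u \<noteq> x \<and> split v {u, x} (V - {v, u, x})"

lemma split_commute: "split v A B \<Longrightarrow> split v B A"
  unfolding split_def using S_sym by blast

lemma split_finite: "split v A B \<Longrightarrow> finite A" "split v A B \<Longrightarrow> finite B"
  unfolding split_def using finite_V by (metis finite_Diff finite_Un)+

lemma split_card: "split v A B \<Longrightarrow> card A + card B = card V - 1"
  using split_finite[of v A B] finite_V unfolding split_def
  by (metis card_Diff_singleton card_Un_disjoint)

lemma twins_commute: "twins v u x \<Longrightarrow> twins v x u"
  unfolding twins_def by (auto simp: insert_commute)

lemma twins_distinct: "twins v u x \<Longrightarrow> v \<noteq> u \<and> v \<noteq> x \<and> u \<noteq> x \<and> v \<in> V \<and> u \<in> V \<and> x \<in> V"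
  unfolding twins_def split_def by auto

lemma twinsI:
  assumes "split v A B" "card A = 2" "u \<in> A" "x \<in> A" "u \<noteq> x"
  shows "twins v u x"
proof -
  have "A = {u, x}"
    using assms(2-5) by (auto simp: card_2_iff)
  moreover have "B = V - {v, u, x}"
    using assms(1) calculation unfolding split_def by blast
  ultimately show ?thesis using assms(1,5) unfolding twins_def by simp
qed

lemma obtain_twin:
  assumes "split v A B" "card A = 2" "u \<in> A"
  obtains x where "A = {u, x}" "u \<noteq> x" "twins v u x"
proof -
  obtain x where "A = {u, x}" "u \<noteq> x"
    using assms(2,3) by (auto simp: card_2_iff)
  then show thesis using that twinsI[OF assms] by blast
qed

end

locale critical_split_relation = split_relation V S for V :: "'v set" and S +
  assumes V_nonempty: "V \<noteq> {}"
    and not_separable: "X \<subseteq> V \<Longrightarrow> S X (V - X) \<Longrightarrow> card X \<le> 1 \<or> card (V - X) \<le> 1"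
    and deletions_split: "v \<in> V \<Longrightarrow> \<exists>A B. split v A B"
begin

lemma two_elements:
  "finite X \<Longrightarrow> a \<in> X \<Longrightarrow> b \<in> X \<Longrightarrow> a \<noteq> b \<Longrightarrow> 2 \<le> card X"
  by (metis One_nat_def card_le_Suc0_iff_eq not_less_eq_eq numeral_2_eq_2)

lemma separated_small:
  assumes "S X (V - X)" "X \<subseteq> V" "a \<in> V - X" "b \<in> V - X" "a \<noteq> b"
  shows "card X \<le> 1"
  using not_separable[OF assms(2,1)] two_elements[OF _ assms(3-5)] finite_V by fastforce

lemma card_V_ge_5: "5 \<le> card V"
proof -
  obtain v where v: "v \<in> V" using V_nonempty by blast
  then obtain A B where "split v A B" using deletions_split by blast
  then show ?thesis using split_card[of v A B] unfolding split_def by linarith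
qed

lemma split_at:
  assumes "u \<in> V" "v \<in> V" "u \<noteq> v"
  obtains C D where "split u C D" "v \<in> D"
proof -
  obtain C D where CD: "split u C D" using deletions_split assms by blast
  then have "v \<in> C \<or> v \<in> D" using assms unfolding split_def by blast
  then show thesis using CD that split_commute by blast
qed

text \<open>The four corners of two crossing splits, of \<open>G - v\<close> and of \<open>G - u\<close>, behave differently
  according to which deleted vertices their complement contains.  The complement of \<open>B \<inter> C\<close>
  is \<open>A \<union> D\<close>, which contains both, so by gluing this corner is separable in the whole graph,
  hence trivial.\<close>

lemma opposite_corner:
  assumes "split v A B" "split u C D" "u \<in> A" "v \<in> D" "A \<inter> D \<noteq> {}"
  shows "card (B \<inter> C) \<le> 1"
proof -
  have "S B A" "S C D" using assms(1,2) S_sym unfolding split_def by auto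
  then have "S (B \<inter> C) A" "S (B \<inter> C) D" using S_mono by (metis Int_lower1 Int_lower2 order_refl)+
  then have "S (B \<inter> C) (A \<union> D)" using S_glue assms(5) by blast
  moreover have "V - (B \<inter> C) \<subseteq> A \<union> D"
    using assms(1-4) unfolding split_def by blast
  ultimately have "S (B \<inter> C) (V - (B \<inter> C))" using S_mono by blast
  moreover have "B \<inter> C \<subseteq> V" "u \<in> V - (B \<inter> C)" "v \<in> V - (B \<inter> C)" "u \<noteq> v"
    using assms(1-4) unfolding split_def by blast+
  ultimately show ?thesis using separated_small by blast
qed

text \<open>Here the complement of \<open>A \<inter> C\<close> misses \<open>u\<close> and contains \<open>v\<close>, so gluing produces a set
  separable in \<open>G - u\<close>: uncrossing moves a split from one deleted vertex to another.\<close>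

lemma adjacent_corner:
  assumes "split v A B" "split u C D" "u \<in> A" "v \<in> D" "B \<inter> D \<noteq> {}"
  shows "S (A \<inter> C) (V - {u} - (A \<inter> C))"
proof -
  have "S A B" "S C D" using assms(1,2) unfolding split_def by auto
  then have "S (A \<inter> C) B" "S (A \<inter> C) D" using S_mono by (metis Int_lower1 Int_lower2 order_refl)+
  then have "S (A \<inter> C) (B \<union> D)" using S_glue assms(5) by blast
  moreover have "V - {u} - (A \<inter> C) \<subseteq> B \<union> D"
    using assms(1-4) unfolding split_def by blast
  ultimately show ?thesis using S_mono by blast
qed

text \<open>A smallest side \<open>A\<close> of any split of any \<open>G - v\<close> is a pair: for \<open>u \<in> A\<close>, uncrossing with a split
  of \<open>G - u\<close> would turn \<open>A \<inter> C\<close> into a smaller side of a split, so \<open>A \<inter> C\<close> has at most one element,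
  and a nonempty \<open>A \<inter> D\<close> would leave \<open>C\<close> smaller than \<open>A\<close>.\<close>

lemma exists_twins: "\<exists>v u x. twins v u x"
proof -
  let ?P = "\<lambda>A. \<exists>v B. split v A B"
  obtain v0 where "v0 \<in> V" using V_nonempty by blast
  then obtain A0 where "?P A0" using deletions_split by blast
  then obtain A where "?P A" and least: "\<And>A'. ?P A' \<Longrightarrow> card A \<le> card A'"
    using ex_has_least_nat[of ?P A0 card] by blast
  then obtain v B where AB: "split v A B" by blast
  obtain u where u: "u \<in> A" using AB unfolding split_def by fastforce
  have uv: "u \<in> V" "v \<in> V" "u \<noteq> v" using AB u unfolding split_def by blast+
  then obtain C D where CD: "split u C D" "v \<in> D" using split_at by blast
  note fin = split_finite[OF AB] split_finite[OF CD(1)]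
  have BD: "B \<inter> D \<noteq> {}"
  proof
    assume empty: "B \<inter> D = {}"
    then have "B \<subseteq> C" using AB CD u unfolding split_def by blast
    then have "B \<inter> C = B" by blast
    then have "\<not> card (B \<inter> C) \<le> 1" using AB unfolding split_def by simp
    then have "A \<inter> D = {}" using opposite_corner[OF AB CD(1) u CD(2)] by blast
    then have "D \<subseteq> {v}" using empty AB CD unfolding split_def by blast
    then have "card D \<le> 1" using card_mono[of "{v}" D] by simp
    then show False using CD unfolding split_def by simp
  qed
  have AC: "card (A \<inter> C) \<le> 1"
  proof (rule ccontr)
    assume big: "\<not> card (A \<inter> C) \<le> 1"
    have "D \<subseteq> V - {u} - (A \<inter> C)" using CD unfolding split_def by blast
    then have "card D \<le> card (V - {u} - (A \<inter> C))"
      by (rule card_mono[rotated]) (simp add: finite_V)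
    then have "split u (A \<inter> C) (V - {u} - (A \<inter> C))"
      using adjacent_corner[OF AB CD(1) u CD(2) BD] big CD unfolding split_def by auto
    then have "card A \<le> card (A \<inter> C)" using least by blast
    moreover have "A \<inter> C \<subset> A" using u CD unfolding split_def by blast
    ultimately show False using psubset_card_mono[of A "A \<inter> C"] fin by simp
  qed
  have AD: "A \<inter> D = {}"
  proof (rule ccontr)
    assume ne: "A \<inter> D \<noteq> {}"
    have "card C \<le> card (A \<inter> C) + card (B \<inter> C)"
    proof -
      have "C = (A \<inter> C) \<union> (B \<inter> C)" using AB CD unfolding split_def by blast
      then show ?thesis using card_Un_le by metis
    qed
    with opposite_corner[OF AB CD(1) u CD(2) ne] AC
    have "card C \<le> 2" "card (A \<inter> C) \<noteq> 0" using CD unfolding split_def by linarith+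
    moreover have "card A \<le> card C" using least CD by blast
    ultimately have "card A \<le> 2" "A \<inter> C \<noteq> {}" by (linarith, force)
    then obtain c d where cd: "c \<in> A" "c \<in> C" "d \<in> A" "d \<in> D" using ne by blast
    have "c \<noteq> d" "u \<noteq> c" "u \<noteq> d" using cd CD unfolding split_def by blast+
    then have "card {u, c, d} = 3" by simp
    moreover have "card {u, c, d} \<le> card A" using card_mono[of A "{u, c, d}"] fin cd u by blast
    ultimately show False using \<open>card A \<le> 2\<close> by simp
  qed
  have "A = insert u (A \<inter> C)" using AD AB CD u unfolding split_def by blast
  then have "card A \<le> 2" using AC card_insert_le_m1[of 2 "A \<inter> C" u] by simp
  then have "card A = 2" using AB unfolding split_def by simp
  then obtain x where "twins v u x" using obtain_twin[OF AB _ u] by metis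
  then show ?thesis by blast
qed

lemma twins_separated:
  assumes "twins v u x" "split u C D" "v \<in> D"
  shows "x \<in> C"
proof (rule ccontr)
  assume "x \<notin> C"
  then have x: "x \<in> D" using assms twins_distinct[OF assms(1)] unfolding split_def by blast
  have tw: "split v {u, x} (V - {v, u, x})" using assms unfolding twins_def by blast
  have "card ((V - {v, u, x}) \<inter> C) \<le> 1"
    using opposite_corner[OF tw assms(2) _ assms(3)] x by blast
  moreover have "(V - {v, u, x}) \<inter> C = C" using assms(2,3) x unfolding split_def by blast
  ultimately show False using assms(2) unfolding split_def by simp
qed

lemma twins_extend:
  assumes "twins v u x" "split u C D" "v \<in> D"
  shows "S (D - {v}) (C \<union> {u, x})"
proof -
  have x: "x \<in> C" using twins_separated[OF assms] .
  have "S D C" using assms(2) S_sym unfolding split_def by blast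
  then have "S (D - {v}) C" by (rule S_mono) auto
  moreover have "S (V - {v, u, x}) {u, x}"
    using assms(1) S_sym unfolding twins_def split_def by blast
  then have "S (D - {v}) {u, x}"
    by (rule S_mono) (use assms(2,3) x in \<open>auto simp: split_def\<close>)
  ultimately show ?thesis using S_glue x by blast
qed

text \<open>If \<open>u\<close> and \<open>x\<close> are twins in \<open>G - v\<close>, every split of \<open>G - u\<close> separates \<open>v\<close> from \<open>x\<close> and every
  split of \<open>G - x\<close> separates \<open>v\<close> from \<open>u\<close>.  Uncrossing one split of each kind, and gluing the corners
  to the sets obtained by adding the missing twin, forces both splits to have a side with two
  elements: either the sides away from \<open>v\<close> or the sides containing \<open>v\<close>.\<close>

context
  fixes v u x C D C' D'
  assumes tw: "twins v u x"
    and CD: "split u C D" "v \<in> D" and CD': "split x C' D'" "v \<in> D'"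
begin

lemma disjoint_sides: "C \<inter> C' = {} \<Longrightarrow> card C = 2"
proof -
  assume disj: "C \<inter> C' = {}"
  note d = twins_distinct[OF tw]
  have x: "x \<in> C" and u: "u \<in> C'"
    using twins_separated[OF tw CD] twins_separated[OF twins_commute[OF tw] CD'] by auto
  let ?b = "C - {x}"
  have "D \<inter> C' \<noteq> {}"
  proof
    assume "D \<inter> C' = {}"
    moreover have "C' \<subseteq> insert u (C \<union> D)" using CD CD' unfolding split_def by auto
    ultimately have "C' \<subseteq> {u}" using disj by blast
    then have "card C' \<le> 1" using card_mono[of "{u}" C'] by simp
    then show False using CD' unfolding split_def by simp
  qed
  then have "S (C \<inter> D') (V - {x} - (C \<inter> D'))"
    using adjacent_corner[OF CD(1) split_commute[OF CD'(1)] x u] by blast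
  moreover have "C \<inter> D' = ?b" using disj CD CD' x u unfolding split_def by blast
  ultimately have 1: "S ?b (V - {x} - ?b)" by simp
  have "S (D' - {v}) (C' \<union> {x, u})" using twins_extend[OF twins_commute[OF tw] CD'] .
  then have 2: "S ?b (C' \<union> {x, u})"
    by (rule S_mono) (use disj CD CD' u in \<open>auto simp: split_def\<close>)
  have "u \<in> (V - {x} - ?b) \<inter> (C' \<union> {x, u})" using d CD unfolding split_def by auto
  then have "S ?b ((V - {x} - ?b) \<union> (C' \<union> {x, u}))" using S_glue[OF 1 2] by blast
  then have "S ?b (V - ?b)" by (rule S_mono) auto
  then have "card ?b \<le> 1"
    by (rule separated_small[of _ u v]) (use d CD in \<open>auto simp: split_def\<close>)
  then show ?thesis using x CD split_finite[OF CD(1)] unfolding split_def by (simp, linarith)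
qed

lemma sides_meeting_once: "D \<inter> D' = {v} \<Longrightarrow> card D = 2"
proof -
  assume meet: "D \<inter> D' = {v}"
  note d = twins_distinct[OF tw]
  have x: "x \<in> C" and u: "u \<in> C'"
    using twins_separated[OF tw CD] twins_separated[OF twins_commute[OF tw] CD'] by auto
  let ?e = "D - {v}"
  have "D' \<inter> C \<noteq> {}"
  proof
    assume "D' \<inter> C = {}"
    then have "D' \<subseteq> {v}" using meet CD CD' u unfolding split_def by blast
    then have "card D' \<le> 1" using card_mono[of "{v}" D'] by simp
    then show False using CD' unfolding split_def by simp
  qed
  then have "S (C' \<inter> D) (V - {u} - (C' \<inter> D))"
    using adjacent_corner[OF CD'(1) split_commute[OF CD(1)] u x] by blast
  moreover have "C' \<inter> D = ?e" using meet CD CD' x u unfolding split_def by blast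
  ultimately have 1: "S ?e (V - {u} - ?e)" by simp
  have 2: "S ?e (C \<union> {u, x})" using twins_extend[OF tw CD] .
  have "x \<in> (V - {u} - ?e) \<inter> (C \<union> {u, x})" using d CD x unfolding split_def by auto
  then have "S ?e ((V - {u} - ?e) \<union> (C \<union> {u, x}))" using S_glue[OF 1 2] by blast
  then have "S ?e (V - ?e)" by (rule S_mono) auto
  then have "card ?e \<le> 1"
    by (rule separated_small[of _ u v]) (use d CD in \<open>auto simp: split_def\<close>)
  then show ?thesis using CD split_finite[OF CD(1)] unfolding split_def by (simp, linarith)
qed

lemma sides_disjoint_or_meeting_once: "C \<inter> C' = {} \<or> D \<inter> D' = {v}"
proof -
  have x: "x \<in> C" and u: "u \<in> C'"
    using twins_separated[OF tw CD] twins_separated[OF twins_commute[OF tw] CD'] by auto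
  have "D \<inter> D' = {v}" if "C \<inter> C' \<noteq> {}"
  proof -
    have "card (D' \<inter> D) \<le> 1"
      using opposite_corner[OF CD'(1) split_commute[OF CD(1)] u x] that by blast
    moreover have "v \<in> D' \<inter> D" using CD CD' by blast
    ultimately have "card (D' \<inter> D) = 1" "v \<in> D' \<inter> D"
      using split_finite[OF CD(1)] by (metis card_0_eq empty_iff finite_Int le_less less_one, blast)
    then show ?thesis by (metis Int_commute card_1_singletonE singletonD)
  qed
  then show ?thesis by blast
qed

end

lemma twins_dichotomy:
  assumes "twins v u x" "split u C D" "v \<in> D" "split x C' D'" "v \<in> D'"
  shows "C \<inter> C' = {} \<and> card C = 2 \<and> card C' = 2 \<or> D \<inter> D' = {v} \<and> card D = 2 \<and> card D' = 2"
  using sides_disjoint_or_meeting_once[OF assms]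
    disjoint_sides[OF assms] disjoint_sides[OF twins_commute[OF assms(1)] assms(4,5,2,3)]
    sides_meeting_once[OF assms] sides_meeting_once[OF twins_commute[OF assms(1)] assms(4,5,2,3)]
  by (metis Int_commute)

section \<open>The cycle of twins\<close>

lemma split_union:
  assumes "split u C D" "split u C2 D2" "C \<inter> C2 \<noteq> {}" "2 \<le> card (D \<inter> D2)"
  shows "split u (C \<union> C2) (D \<inter> D2)"
proof -
  have "S D C" "S D2 C2" using assms(1,2) S_sym unfolding split_def by auto
  then have "S (D \<inter> D2) C" "S (D \<inter> D2) C2" using S_mono by (metis Int_lower1 Int_lower2 order_refl)+
  then have "S (C \<union> C2) (D \<inter> D2)" using S_glue S_sym assms(3) by blast
  moreover have "2 \<le> card (C \<union> C2)"
    using assms(1) split_finite[OF assms(1)] split_finite[OF assms(2)] card_mono[of "C \<union> C2" C]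
    unfolding split_def by auto
  moreover have "C \<union> C2 \<union> D \<inter> D2 = V - {u}"
  proof -
    have "C \<union> D = V - {u}" "C2 \<union> D2 = V - {u}" using assms(1,2) unfolding split_def by auto
    then show ?thesis by blast
  qed
  ultimately show ?thesis using assms unfolding split_def by blast
qed

lemma card_Un_meeting_pairs:
  assumes "card X = 2" "card Y = 2" "a \<in> X" "a \<in> Y" "X \<noteq> Y"
  shows "card (X \<union> Y) = 3"
proof -
  obtain x y where "X = {a, x}" "Y = {a, y}" "a \<noteq> x" "a \<noteq> y"
    using assms(1-4) by (auto simp: card_2_iff)
  then show ?thesis using assms(5) by (auto simp: card_insert_if)
qed

text \<open>The two cases correspond to two pictures of a cycle through the twins \<open>u\<close> and \<open>x\<close>, each vertex
  having its cycle neighbours as twins: in the outer case \<open>u\<close> and \<open>x\<close> are the neighbours of \<open>v\<close>; in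
  the inner case \<open>u\<close> and \<open>x\<close> are adjacent and \<open>v\<close> is no neighbour of either.\<close>

lemma twins_cases:
  assumes tw: "twins v u x"
  obtains
    (inner) y z where "twins u x y" "twins x u z" "y \<noteq> z" "y \<noteq> v" "z \<noteq> v"
  | (outer) t t' where "twins u v t" "twins x v t'" "t \<noteq> t'" "t \<noteq> x" "t' \<noteq> u"
proof -
  note d = twins_distinct[OF tw]
  obtain C D where CD: "split u C D" "v \<in> D" using split_at d by metis
  obtain C' D' where CD': "split x C' D'" "v \<in> D'" using split_at d by metis
  have x: "x \<in> C" and u: "u \<in> C'"
    using twins_separated[OF tw CD] twins_separated[OF twins_commute[OF tw] CD'] by auto
  have dis: "C \<inter> D = {}" "C' \<inter> D' = {}" using CD CD' unfolding split_def by auto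
  from twins_dichotomy[OF tw CD CD'] show thesis
  proof (elim disjE conjE)
    assume h: "C \<inter> C' = {}" "card C = 2" "card C' = 2"
    obtain y where y: "C = {x, y}" "x \<noteq> y" "twins u x y" using obtain_twin[OF CD(1) h(2) x] .
    obtain z where z: "C' = {u, z}" "u \<noteq> z" "twins x u z" using obtain_twin[OF CD'(1) h(3) u] .
    show thesis by (rule inner[of y z]) (use y z h(1) dis CD(2) CD'(2) in auto)
  next
    assume h: "D \<inter> D' = {v}" "card D = 2" "card D' = 2"
    obtain t where t: "D = {v, t}" "v \<noteq> t" "twins u v t"
      using obtain_twin[OF split_commute[OF CD(1)] h(2) CD(2)] .
    obtain t' where t': "D' = {v, t'}" "v \<noteq> t'" "twins x v t'"
      using obtain_twin[OF split_commute[OF CD'(1)] h(3) CD'(2)] .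
    show thesis by (rule outer[of t t']) (use t t' h(1) dis x u in auto)
  qed
qed

text \<open>Vertices that are a twin of something: these are the vertices whose own split is under control
  by the dichotomy, and they will be the vertices of the cycle.\<close>

definition paired :: "'v \<Rightarrow> bool" where
  "paired u \<longleftrightarrow> (\<exists>v x. twins v u x)"

context
  assumes large: "6 \<le> card V"
begin

text \<open>Both splits of \<open>G - u\<close> have a two-element side of the same kind, as the kind is read off from a
  common split of \<open>G - x\<close>, only one side of which has two elements when there are at least six
  vertices.  The union of two different such pairs would be a side of a third split, with three
  elements, which the dichotomy excludes.\<close>

lemma unique_split_oriented:
  assumes tw: "twins v u x"
    and CD: "split u C D" "v \<in> D" and CD2: "split u C2 D2" "v \<in> D2"
  shows "C = C2"
proof (rule ccontr)
  assume ne: "C \<noteq> C2"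
  have part: "C = V - {u} - D" "C2 = V - {u} - D2" "D = V - {u} - C" "D2 = V - {u} - C2"
    using CD CD2 unfolding split_def by blast+
  then have neD: "D \<noteq> D2" using ne by blast
  note d = twins_distinct[OF tw]
  obtain C' D' where CD': "split x C' D'" "v \<in> D'" using split_at d by metis
  have x: "x \<in> C" "x \<in> C2"
    using twins_separated[OF tw CD] twins_separated[OF tw CD2] by auto
  have large': "card C' + card D' \<ge> 5" using split_card[OF CD'(1)] large by linarith
  have cardu: "card (V - {u} - X) = card V - 1 - card X" if "X \<subseteq> V - {u}" for X
    using that d finite_V by (simp add: card_Diff_subset finite_subset)
  from twins_dichotomy[OF tw CD CD'] show False
  proof (elim disjE conjE)
    assume h: "card C = 2" "card C' = 2"
    then have "card C2 = 2" using twins_dichotomy[OF tw CD2 CD'] large' by linarith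
    then have three: "card (C \<union> C2) = 3" using card_Un_meeting_pairs h x ne by metis
    have "D \<inter> D2 = V - {u} - (C \<union> C2)" "C \<union> C2 \<subseteq> V - {u}" using part by blast+
    then have "card (D \<inter> D2) = card V - 4" using cardu[of "C \<union> C2"] three by simp
    then have "2 \<le> card (D \<inter> D2)" using large by linarith
    moreover have "C \<inter> C2 \<noteq> {}" using x by blast
    ultimately have "split u (C \<union> C2) (D \<inter> D2)" using split_union[OF CD(1) CD2(1)] by blast
    moreover have "v \<in> D \<inter> D2" using CD CD2 by blast
    ultimately have "card (C \<union> C2) = 2 \<or> card D' = 2" using twins_dichotomy[OF tw _ _ CD'] by blast
    then show False using three h large' by linarith
  next
    assume h: "card D = 2" "card D' = 2"
    then have "card D2 = 2" using twins_dichotomy[OF tw CD2 CD'] large' by linarith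
    then have three: "card (D \<union> D2) = 3" using card_Un_meeting_pairs h CD(2) CD2(2) neD by metis
    have "C \<inter> C2 = V - {u} - (D \<union> D2)" "D \<union> D2 \<subseteq> V - {u}" using part by blast+
    then have "card (C \<inter> C2) = card V - 4" using cardu[of "D \<union> D2"] three by simp
    then have "2 \<le> card (C \<inter> C2)" using large by linarith
    moreover have "D \<inter> D2 \<noteq> {}" using CD CD2 by blast
    ultimately have "split u (D \<union> D2) (C \<inter> C2)"
      using split_union[OF split_commute[OF CD(1)] split_commute[OF CD2(1)]] by blast
    then have "split u (C \<inter> C2) (D \<union> D2)" using split_commute by blast
    moreover have "v \<in> D \<union> D2" using CD by blast
    ultimately have "card C' = 2 \<or> card (D \<union> D2) = 2" using twins_dichotomy[OF tw _ _ CD'] by blast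
    then show False using three h large' by linarith
  qed
qed

lemma unique_split:
  assumes "paired u" "split u C D" "split u C2 D2"
  shows "C = C2 \<or> C = D2"
proof -
  obtain v x where tw: "twins v u x" using assms unfolding paired_def by blast
  have part: "C = V - {u} - D" "C2 = V - {u} - D2" "D = V - {u} - C" "D2 = V - {u} - C2"
    using assms unfolding split_def by blast+
  have "v \<in> C \<or> v \<in> D" "v \<in> C2 \<or> v \<in> D2"
    using assms twins_distinct[OF tw] unfolding split_def by blast+
  then have "C = C2 \<or> C = D2 \<or> D = C2 \<or> D = D2"
    using unique_split_oriented[OF tw] assms split_commute by meson
  then show ?thesis using part by blast
qed

lemma unique_twins:
  assumes "paired u" "twins u a b" "twins u c d"
  shows "{a, b} = {c, d}"
proof -
  have s: "split u {a, b} (V - {u, a, b})" "split u {c, d} (V - {u, c, d})" "a \<noteq> b" "c \<noteq> d"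
    using assms unfolding twins_def by auto
  have "card (V - {u, c, d}) \<noteq> 2" using split_card[OF s(2)] s(4) large by simp
  moreover have "card {a, b} = 2" using s by simp
  ultimately have "{a, b} \<noteq> V - {u, c, d}" by metis
  then show ?thesis using unique_split[OF assms(1) s(1,2)] by blast
qed

text \<open>On paired vertices being a twin is a symmetric relation, so the paired vertices form a
  \<open>2\<close>-regular graph; \<open>t \<noteq> t'\<close>, \<open>t \<noteq> x\<close> and \<open>t' \<noteq> u\<close> say that this graph has no cycle of length
  four or three.  The inner case is impossible because \<open>v\<close> would then be a twin of \<open>u\<close> or of \<open>x\<close>, whose
  unique pairs of twins do not contain \<open>v\<close>.\<close>

lemma paired_symmetric:
  assumes v: "paired v" and tw: "twins v u x"
  obtains t t' where "twins u v t" "twins x v t'" "t \<noteq> t'" "t \<noteq> x" "t' \<noteq> u"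
  using tw
proof (cases rule: twins_cases)
  case (inner y z)
  note d = twins_distinct[OF tw]
  have ux: "paired u" "paired x" using tw twins_commute unfolding paired_def by blast+
  obtain w p where wp: "twins w v p" using v unfolding paired_def by blast
  have no: "\<not> twins u v s" "\<not> twins x v s" for s
    using unique_twins[OF ux(1) inner(1), of v s] unique_twins[OF ux(2) inner(2), of v s] inner d
    by blast+
  from wp have False
  proof (cases rule: twins_cases)
    case (inner y' z')
    then have "p \<in> {u, x}" using unique_twins[OF v tw] by blast
    then show False using no inner(2) by blast
  next
    case (outer s s')
    then have "w \<in> {u, x}" using unique_twins[OF v tw] by blast
    then show False using no wp by blast
  qed
  then show thesis ..
qed (use that in blast)

text \<open>Walking through the \<open>2\<close>-regular graph without turning back; the state of the walk is the pair of
  the last two vertices.\<close>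

lemma exists_twin_path:
  obtains p :: "nat \<Rightarrow> 'v" where "\<And>i. paired (p i)" "\<And>i. twins (p (Suc i)) (p i) (p (Suc (Suc i)))"
proof -
  let ?P = "\<lambda>(_::nat) (a, c). paired a \<and> paired c \<and> (\<exists>b. twins c a b)"
  let ?Q = "\<lambda>(_::nat) (a, c) (c', b). c' = c \<and> twins c a b"
  obtain v u x where vux: "twins v u x" using exists_twins by blast
  then have u: "paired u" unfolding paired_def by blast
  obtain a b where uab: "twins u a b" using vux by (cases rule: twins_cases) blast+
  then have a: "paired a" unfolding paired_def by blast
  have "\<exists>f. \<forall>n. ?P n (f n) \<and> ?Q n (f n) (f (Suc n))"
  proof (rule dependent_nat_choice)
    show "\<exists>s. ?P 0 s" using u a uab by blast
  next
    fix s n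
    assume "?P n s"
    then obtain a c b where s: "s = (a, c)" "paired c" "twins c a b" by auto
    then have "paired b" using twins_commute unfolding paired_def by blast
    moreover obtain t' where "twins b c t'" using s by (meson paired_symmetric)
    ultimately show "\<exists>s'. ?P (Suc n) s' \<and> ?Q n s s'" using s by auto
  qed
  then obtain f where "\<forall>n. ?P n (f n) \<and> ?Q n (f n) (f (Suc n))" ..
  then have f: "?P n (f n)" "?Q n (f n) (f (Suc n))" for n by auto
  have step: "fst (f (Suc n)) = snd (f n)" "twins (snd (f n)) (fst (f n)) (snd (f (Suc n)))" for n
    using f(2)[of n] by (auto simp: case_prod_beta)
  show thesis
  proof (rule that[of "fst \<circ> f"])
    show "paired ((fst \<circ> f) i)" for i using f(1)[of i] by (auto simp: case_prod_beta)
    show "twins ((fst \<circ> f) (Suc i)) ((fst \<circ> f) i) ((fst \<circ> f) (Suc (Suc i)))" for i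
      using step[of i] step(1)[of "Suc i"] by simp
  qed
qed

end

text \<open>Indices are meant modulo \<open>L\<close>; the two places where they wrap around are spelled out.\<close>

definition twin_cycle :: "(nat \<Rightarrow> 'v) \<Rightarrow> nat \<Rightarrow> bool" where
  "twin_cycle p L \<longleftrightarrow> 5 \<le> L \<and> inj_on p {..<L} \<and>
    (\<forall>i. Suc (Suc i) < L \<longrightarrow> twins (p (Suc i)) (p i) (p (Suc (Suc i)))) \<and>
    twins (p (L - 1)) (p (L - 2)) (p 0) \<and> twins (p 0) (p (L - 1)) (p 1)"

text \<open>The first repetition on the walk must return to the starting vertex, since every other vertex
  already has both of its neighbours.\<close>

lemma twin_cycle_large:
  assumes large: "6 \<le> card V"
  shows "\<exists>p L. twin_cycle p L"
proof -
  obtain p where pd: "\<And>i. paired (p i)" and tw: "\<And>i. twins (p (Suc i)) (p i) (p (Suc (Suc i)))"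
    using exists_twin_path[OF large] by blast
  note uniq = unique_twins[OF large pd]
  have dist: "p i \<noteq> p (Suc i)" "p i \<noteq> p (Suc (Suc i))" "p i \<in> V" for i
    using twins_distinct[OF tw[of i]] by auto
  let ?R = "\<lambda>j. \<exists>i<j. p j = p i"
  have "\<not> inj p"
  proof
    assume "inj p"
    moreover have "range p \<subseteq> V" using dist(3) by blast
    ultimately show False using finite_V finite_subset finite_imageD by (metis infinite_UNIV_nat)
  qed
  then obtain a b where "p a = p b" "a \<noteq> b" by (auto simp: inj_def)
  then have "?R (max a b)" by (metis max_def nat_neq_iff order.strict_implies_order leD)
  \<comment> \<open>The first position whose vertex has occurred before; it will be the length of the cycle.\<close>
  define L where "L = (LEAST j. ?R j)"
  have L: "?R L" unfolding L_def using \<open>?R (max a b)\<close> by (rule LeastI)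
  have least: "\<not> ?R j" if "j < L" for j using not_less_Least[of j ?R] that unfolding L_def by blast
  have inj: "inj_on p {..<L}"
    using least by (metis (no_types, lifting) inj_onI lessThan_iff linorder_neqE_nat)
  obtain i where i: "i < L" "p L = p i" using L by blast
  obtain L' where L': "L = Suc L'" using i by (cases L) auto
  have "i = 0"
  proof (rule ccontr)
    assume "i \<noteq> 0"
    then obtain i' where i': "i = Suc i'" by (cases i) auto
    have "{p L', p (Suc L)} = {p i', p (Suc i)}"
      using uniq[of L "p L'" "p (Suc L)" "p i'" "p (Suc i)"] tw[of L'] tw[of i'] i(2) i' L' by auto
    then consider "p L' = p i'" | "p L' = p (Suc i)" by blast
    then show False
    proof cases
      case 1
      then show False using inj_onD[OF inj 1] i i' L' by simp
    next
      case 2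
      show False
      proof (cases "Suc i < L")
        case True
        then have "L' = Suc i" using 2 inj L' by (auto simp: inj_on_def)
        then show False using dist(2)[of i] i L' by simp
      next
        case False
        then have "L = Suc i" using i by simp
        then show False using dist(1)[of i] i by simp
      qed
    qed
  qed
  then have close: "p L = p 0" using i by simp
  have "L \<noteq> 1" "L \<noteq> 2" using close dist[of 0] by (auto simp: numeral_2_eq_2)
  then have L3: "3 \<le> L" using i by linarith
  obtain t t' where t: "twins (p 0) (p 1) t" "twins (p 2) (p 1) t'" "t \<noteq> t'" "t \<noteq> p 2" "t' \<noteq> p 0"
    using paired_symmetric[OF large pd tw[of 0]] by (metis One_nat_def numeral_2_eq_2)
  have last: "twins (p 0) (p L') (p (Suc L))" using tw[of L'] close L' by simp
  have "{p L', p (Suc L)} = {p 1, t}" using uniq[OF last t(1)] .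
  moreover have "p L' \<noteq> p 1" using inj_onD[OF inj, of L' 1] L' L3 by auto
  ultimately have tL: "t = p L'" by auto
  have "L \<noteq> 3"
    using tL t(4) L' by (auto simp: numeral_3_eq_3 numeral_2_eq_2)
  moreover have "L \<noteq> 4"
  proof
    assume "L = 4"
    then have "L' = 3" using L' by simp
    have "twins (p 2) (p 1) (p 3)" using tw[of 1] by (simp add: numeral_3_eq_3 numeral_2_eq_2)
    then have "{p 1, p 3} = {p 1, t'}" using uniq t(2) by blast
    then show False using tL t(3) \<open>L' = 3\<close> by (metis doubleton_eq_iff)
  qed
  ultimately have "5 \<le> L" using L3 by linarith
  moreover have "twins (p (L - 1)) (p (L - 2)) (p 0)"
    using tw[of "L - 2"] close L3 by (simp add: Suc_diff_Suc numeral_2_eq_2)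
  moreover have "twins (p 0) (p (L - 1)) (p 1)" using t(1) tL L' twins_commute by simp
  ultimately have "twin_cycle p L" unfolding twin_cycle_def using inj tw by blast
  then show ?thesis by blast
qed

text \<open>With five vertices every split has two sides of size two, so the two cases of
  \<open>twins_cases\<close> describe the same pair of splits from complementary sides.\<close>

lemma twins_five:
  assumes five: "card V = 5" and tw: "twins v u x"
  obtains y z where "V = {v, u, x, y, z}" "distinct [v, u, x, y, z]"
    "twins u x y" "twins u v z" "twins x u z" "twins x v y"
proof -
  note d = twins_distinct[OF tw]
  have complement: "twins a d e" if "twins a b c" "V = {a, b, c, d, e}" for a b c d e
  proof -
    have "distinct [a, b, c, d, e]" using that(2) five by (auto simp: card_insert_if split: if_splits)
    then show ?thesis
      using that split_commute[of a "{b, c}" "V - {a, b, c}"]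
      unfolding twins_def by (auto simp: insert_Diff_if insert_commute)
  qed
  have fin: "finite (V - {v, u, x})" using finite_V by simp
  have "card (V - {v, u, x}) = 2" using five d finite_V by (simp add: card_Diff_subset)
  then obtain r s where rs: "V - {v, u, x} = {r, s}" "r \<noteq> s" by (auto simp: card_2_iff)
  then have V: "V = {v, u, x, r, s}" using d by blast
  have dis: "distinct [v, u, x, r, s]" using V five by (auto simp: card_insert_if split: if_splits)
  from tw show thesis
  proof (cases rule: twins_cases)
    case (inner y z)
    have "y \<in> V" "z \<in> V" "y \<noteq> u" "y \<noteq> x" "z \<noteq> u" "z \<noteq> x"
      using twins_distinct[OF inner(1)] twins_distinct[OF inner(2)] by auto
    then have V': "V = {v, u, x, y, z}" using inner V dis by auto
    show thesis
      by (rule that[OF V' _ inner(1) _ inner(2)])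
        (use V' dis five inner complement[OF inner(1), of v z] complement[OF inner(2), of v y]
          \<open>y \<noteq> u\<close> \<open>y \<noteq> x\<close> \<open>z \<noteq> u\<close> \<open>z \<noteq> x\<close> in \<open>auto simp: insert_commute\<close>)
  next
    case (outer z y)
    have "y \<in> V" "z \<in> V" "y \<noteq> v" "y \<noteq> x" "z \<noteq> u" "z \<noteq> v"
      using twins_distinct[OF outer(1)] twins_distinct[OF outer(2)] by auto
    then have V': "V = {v, u, x, y, z}" using outer V dis by auto
    show thesis
      by (rule that[OF V' _ _ outer(1) _ outer(2)])
        (use V' dis five outer complement[OF outer(1), of x y] complement[OF outer(2), of u z]
          \<open>y \<noteq> v\<close> \<open>y \<noteq> x\<close> \<open>z \<noteq> u\<close> \<open>z \<noteq> v\<close> in \<open>auto simp: insert_commute\<close>)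
  qed
qed

lemma twins_asymmetric:
  assumes "twins v u x"
  shows "\<not> twins u x v"
proof
  assume t: "twins u x v"
  then have s: "split u (V - {u, x, v}) {x, v}" using split_commute unfolding twins_def by blast
  show False using twins_separated[OF assms s] by auto
qed

text \<open>Splits are \<open>2 + 2\<close> partitions, and the dichotomy fixes all five of them once one is given;
  they are the splits of a pentagon into the neighbours and the non-neighbours of the deleted vertex.\<close>

lemma twin_cycle_five:
  assumes five: "card V = 5"
  shows "\<exists>p L. twin_cycle p L"
proof -
  obtain v u x where vux: "twins v u x" using exists_twins by blast
  obtain r s where rs: "V = {v, u, x, r, s}" "distinct [v, u, x, r, s]"
    "twins u x r" "twins u v s" "twins x u s" "twins x v r"
    using twins_five[OF five vux] .
  have no: "\<not> twins u x v" "\<not> twins x u v"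
    using twins_asymmetric vux twins_commute by blast+
  obtain y z where yz: "V = {u, x, r, y, z}" "distinct [u, x, r, y, z]" "twins x u z" "twins r x z"
    using twins_five[OF five rs(3)] by blast
  have "z \<noteq> v" using yz no by blast
  moreover have "z \<in> {v, u, x, r, s}" using yz(1) unfolding rs(1)[symmetric] by simp
  ultimately have "z = s" using yz(2) by auto
  obtain y' z' where yz': "V = {x, u, s, y', z'}" "distinct [x, u, s, y', z']" "twins u x z'" "twins s u z'"
    using twins_five[OF five rs(5)] by blast
  have "z' \<noteq> v" using yz' no by blast
  moreover have "z' \<in> {v, u, x, r, s}" using yz'(1) unfolding rs(1)[symmetric] by simp
  ultimately have "z' = r" using yz'(2) by auto
  let ?p = "nth [v, u, s, r, x]"
  have "twin_cycle ?p 5"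
    unfolding twin_cycle_def
  proof (intro conjI allI impI)
    show "inj_on ?p {..<5}" using rs(2) by (auto simp: inj_on_def less_Suc_eq numeral_eq_Suc)
    show "twins (?p (Suc i)) (?p i) (?p (Suc (Suc i)))" if "Suc (Suc i) < 5" for i
    proof -
      have "i = 0 \<or> i = 1 \<or> i = 2" using that by linarith
      then show ?thesis using rs yz(4) yz'(4) \<open>z = s\<close> \<open>z' = r\<close> twins_commute by auto
    qed
  qed (use rs vux twins_commute in \<open>auto simp: numeral_eq_Suc\<close>)
  then show ?thesis by blast
qed

theorem exists_twin_cycle: "\<exists>p L. twin_cycle p L"
proof -
  have "card V = 5 \<or> 6 \<le> card V" using card_V_ge_5 by linarith
  then show ?thesis using twin_cycle_large twin_cycle_five by blast
qed

end

context critical_split_relation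
begin

section \<open>The weights determined by a cycle of twins\<close>

lemma twin_cycle_in_V:
  assumes "twin_cycle p L" "i < L"
  shows "p i \<in> V"
proof -
  consider "i = 0" | "i = L - 1" | j where "i = Suc j" "Suc (Suc j) < L"
    using assms(2) by (cases i) (auto, force)
  then show ?thesis
    using assms(1) twins_distinct unfolding twin_cycle_def by cases blast+
qed

text \<open>Now \<open>N\<close> stands for the weights of the switching that isolates \<open>p 0\<close>.  With an isolated vertex
  on one side, separability becomes homogeneity: all vertices of \<open>X\<close> have the same weight to each
  vertex outside.  What remains is a path \<open>p 1, \<dots>, p (L - 1)\<close>, which determines all weights.\<close>

context
  fixes p :: "nat \<Rightarrow> 'v" and L :: nat and N :: "'v \<Rightarrow> 'v \<Rightarrow> 'c"
  assumes cyc: "twin_cycle p L"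
    and N_sym: "\<And>x y. x \<in> V \<Longrightarrow> y \<in> V \<Longrightarrow> N x y = N y x"
    and N_base: "\<And>x y. x \<in> V \<Longrightarrow> y \<in> V \<Longrightarrow> N x (p 0) = N y (p 0)"
    and S_iff: "\<And>X Y. X \<subseteq> V \<Longrightarrow> Y \<subseteq> V \<Longrightarrow> X \<inter> Y = {} \<Longrightarrow> p 0 \<in> Y \<Longrightarrow>
      S X Y \<longleftrightarrow> (\<forall>x\<in>X. \<forall>x'\<in>X. \<forall>y\<in>Y. N x y = N x' y)"
begin

lemma L5: "5 \<le> L" and p_inj: "inj_on p {..<L}" and p_V: "i < L \<Longrightarrow> p i \<in> V"
  using cyc twin_cycle_in_V[OF cyc] unfolding twin_cycle_def by auto

lemma p_eq: "i < L \<Longrightarrow> j < L \<Longrightarrow> p i = p j \<longleftrightarrow> i = j"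
  using p_inj by (auto simp: inj_on_def)

text \<open>The inequality is the point where nonseparability enters: equality also at \<open>c\<close> would make
  \<open>{a, b}\<close> separable in the whole graph.\<close>

lemma row_eq:
  assumes tw: "twins c a b" and base: "p 0 \<notin> {c, a, b}"
  shows "w \<in> V - {c, a, b} \<Longrightarrow> N a w = N b w" "N a c \<noteq> N b c"
proof -
  note d = twins_distinct[OF tw]
  have b: "p 0 \<in> V - {c, a, b}" using base p_V[of 0] L5 by auto
  have S: "S {a, b} (V - {c, a, b})" using tw unfolding twins_def split_def by blast
  then show eq: "N a w = N b w" if "w \<in> V - {c, a, b}" for w
    using iffD1[OF S_iff[of "{a, b}" "V - {c, a, b}"]] d b that by blast
  show "N a c \<noteq> N b c"
  proof
    assume "N a c = N b c"
    then have "N a w = N b w" if "w \<in> V - {a, b}" for w using eq[of w] that by (cases "w = c") auto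
    then have "\<forall>x\<in>{a, b}. \<forall>x'\<in>{a, b}. \<forall>y\<in>V - {a, b}. N x y = N x' y" by simp
    then have "S {a, b} (V - {a, b})" using S_iff[of "{a, b}" "V - {a, b}"] d b by blast
    then have "card {a, b} \<le> 1" by (rule separated_small[of _ c "p 0"]) (use b d in auto)
    then show False using d by simp
  qed
qed

text \<open>A twin of the isolated vertex has a constant row, since the isolated vertex has one.\<close>

lemma row_const:
  assumes tw: "twins c (p 0) b"
  shows "w \<in> V - {c, p 0, b} \<Longrightarrow> w' \<in> V - {c, p 0, b} \<Longrightarrow> N b w = N b w'"
    "w \<in> V - {c, p 0, b} \<Longrightarrow> N b c \<noteq> N b w"
proof -
  note d = twins_distinct[OF tw]
  have S: "S (V - {c, p 0, b}) {p 0, b}"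
    using tw S_sym unfolding twins_def split_def by blast
  then show eq: "N b w = N b w'" if "w \<in> V - {c, p 0, b}" "w' \<in> V - {c, p 0, b}" for w w'
  proof -
    have "N w b = N w' b" using iffD1[OF S_iff[of "V - {c, p 0, b}" "{p 0, b}"] S] d that by blast
    then show ?thesis using N_sym[of b w] N_sym[of b w'] d that by simp
  qed
  show "N b c \<noteq> N b w" if w: "w \<in> V - {c, p 0, b}"
  proof
    assume "N b c = N b w"
    then have "N b x = N b w" if "x \<in> V - {p 0, b}" for x
      using eq[of x w] w that by (cases "x = c") auto
    then have "N x b = N b w" if "x \<in> V - {p 0, b}" for x
      using that d N_sym[of x b] by auto
    then have "\<forall>x\<in>V - {p 0, b}. \<forall>x'\<in>V - {p 0, b}. \<forall>y\<in>{p 0, b}. N x y = N x' y"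
      using N_base by auto
    then have "S (V - {p 0, b}) {p 0, b}" using S_iff[of "V - {p 0, b}" "{p 0, b}"] d by blast
    then have "S {p 0, b} (V - {p 0, b})" using S_sym by blast
    then have "card {p 0, b} \<le> 1" by (rule separated_small[of _ c w]) (use w d in auto)
    then show False using d by simp
  qed
qed

lemma step_eq:
  assumes "1 \<le> i" "i + 2 < L" "w \<in> V" "w \<noteq> p i" "w \<noteq> p (i + 1)" "w \<noteq> p (i + 2)"
  shows "N (p i) w = N (p (i + 2)) w"
proof -
  have "twins (p (i + 1)) (p i) (p (i + 2))" using cyc assms(2) unfolding twin_cycle_def by simp
  then show ?thesis by (rule row_eq) (use assms p_eq in auto)
qed

text \<open>These turn out to be the two weights occurring off \<open>p 0\<close>.\<close>

definition "common_wt = N (p 2) (p 3)"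
definition "flipped_wt = N (p 2) (p 1)"

lemma second_row: "w \<in> V - {p 0, p 1, p 2} \<Longrightarrow> N (p 2) w = common_wt" "flipped_wt \<noteq> common_wt"
proof -
  have "Suc (Suc 0) < L" using L5 by simp
  then have "twins (p (Suc 0)) (p 0) (p (Suc (Suc 0)))" using cyc unfolding twin_cycle_def by blast
  then have tw: "twins (p 1) (p 0) (p 2)" by (simp add: numeral_2_eq_2)
  have 3: "p 3 \<in> V - {p 1, p 0, p 2}" using p_V p_eq L5 by auto
  show "N (p 2) w = common_wt" if "w \<in> V - {p 0, p 1, p 2}"
    unfolding common_wt_def by (rule row_const(1)[OF tw]) (use that 3 in auto)
  show "flipped_wt \<noteq> common_wt" unfolding common_wt_def flipped_wt_def by (rule row_const(2)[OF tw 3])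
qed

text \<open>Rows of consecutive even vertices agree away from the three path vertices involved, so the
  constant row of \<open>p 2\<close> propagates along the path to everything ahead.\<close>

lemma even_row:
  "1 \<le> k \<Longrightarrow> 2 * k < L \<Longrightarrow> w \<in> V \<Longrightarrow> w \<notin> p ` {..2 * k} \<Longrightarrow> N (p (2 * k)) w = common_wt"
proof (induction k rule: nat_induct_at_least)
  case base
  then show ?case using second_row(1)[of w] by (auto simp: image_iff)
next
  case (Suc k)
  have "w \<notin> p ` {..2 * k}" using Suc.prems by auto
  then have "N (p (2 * k)) w = common_wt" using Suc by simp
  moreover have "w \<noteq> p j" if "j \<le> 2 * k + 2" for j using Suc.prems that by auto
  then have "N (p (2 * k)) w = N (p (2 * k + 2)) w"
    by (intro step_eq) (use Suc in auto)
  ultimately show ?case by simp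
qed

text \<open>Passing an odd vertex flips its weight from \<open>common_wt\<close> to something else; that the new weight
  is always the same follows by comparing rows of consecutive odd vertices.\<close>

lemma even_row_below:
  "1 \<le> k \<Longrightarrow> 2 * k < L \<Longrightarrow> m < k \<Longrightarrow> N (p (2 * k)) (p (2 * m + 1)) = flipped_wt"
proof (induction k arbitrary: m rule: nat_induct_at_least)
  case base
  then show ?case by (simp add: flipped_wt_def)
next
  case (Suc k)
  have below: "N (p (2 * Suc k)) (p (2 * m + 1)) = flipped_wt" if "m < k" for m
  proof -
    have "N (p (2 * k)) (p (2 * m + 1)) = N (p (2 * k + 2)) (p (2 * m + 1))"
      by (intro step_eq p_V) (use Suc that p_eq in auto)
    then show ?thesis using Suc that by simp
  qed
  show ?case
  proof (cases "m = k")
    case True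
    obtain k' where k': "k = Suc k'" using Suc by (cases k) auto
    have "N (p (2 * k' + 1)) (p (2 * Suc k)) = N (p (2 * k' + 1 + 2)) (p (2 * Suc k))"
      by (intro step_eq p_V) (use Suc k' p_eq in auto)
    then have "N (p (2 * Suc k)) (p (2 * k' + 1)) = N (p (2 * Suc k)) (p (2 * k + 1))"
      using N_sym p_V Suc.prems k' by simp
    then show ?thesis using below[of k'] k' True by simp
  next
    case False
    then show ?thesis using below Suc.prems by simp
  qed
qed

text \<open>For even \<open>L\<close> the second to last vertex \<open>p (L - 2)\<close> would have even index and also, being a twin of
  \<open>p 0\<close>, a constant row; but its weights to \<open>p 1\<close> and \<open>p 2\<close> differ.\<close>

lemma odd_L: "odd L"
proof
  assume "even L"
  then obtain K' where "L = 2 * K'" by (auto elim: evenE)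
  then obtain K where L: "L = 2 * K + 2" and K: "2 \<le> K" using L5 that[of "K' - 1"] by (cases K') auto
  have tw: "twins (p (2 * K + 1)) (p 0) (p (2 * K))"
    using cyc L twins_commute unfolding twin_cycle_def by simp
  have "N (p (2 * K)) (p 1) = N (p (2 * K)) (p 2)"
    by (rule row_const[OF tw]) (use L K p_V p_eq in auto)
  moreover have "N (p (2 * K)) (p 1) = flipped_wt" using even_row_below[of K 0] L K by simp
  moreover have "N (p (2 * K)) (p 2) = common_wt"
    using second_row(1)[of "p (2 * K)"] N_sym[of "p (2 * K)" "p 2"] p_V p_eq L K by auto
  ultimately show False using second_row(2) by simp
qed

text \<open>For odd \<open>L\<close> the path read backwards starts with the twin \<open>p (L - 2)\<close> of \<open>p 0\<close>, so constant rows
  propagate along the odd vertices from the far end.\<close>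

lemma odd_row:
  assumes L: "L = 2 * K + 1" and "m < K" "w \<in> V" "w \<noteq> p 0" "w \<notin> p ` {2 * m + 1..<L}"
  shows "N (p (2 * m + 1)) w = common_wt"
proof -
  have K: "2 \<le> K" using L L5 by simp
  have "m \<le> K - 1" using assms by simp
  then show ?thesis using assms(3-5)
  proof (induction m rule: inc_induct)
    case base
    have tw: "twins (p (2 * K)) (p 0) (p (2 * (K - 1) + 1))"
    proof -
      have "2 * (K - 1) + 1 = L - 2" "2 * K = L - 1" using L K by auto
      then show ?thesis using cyc twins_commute unfolding twin_cycle_def by metis
    qed
    have "w \<noteq> p (2 * K)" "w \<noteq> p (2 * (K - 1) + 1)" using base L K by auto
    then have "N (p (2 * (K - 1) + 1)) w = N (p (2 * (K - 1) + 1)) (p 2)"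
      using base L K p_V p_eq by (intro row_const[OF tw]) auto
    also have "\<dots> = N (p 2) (p (2 * (K - 1) + 1))" using N_sym p_V L K by simp
    also have "\<dots> = common_wt" using second_row(1)[of "p (2 * (K - 1) + 1)"] p_V p_eq L K by auto
    finally show ?case .
  next
    case (step m)
    have "w \<noteq> p j" if "2 * m + 1 \<le> j" "j < L" for j using step.prems that by auto
    then have "N (p (2 * m + 1)) w = N (p (2 * m + 1 + 2)) w"
      using step L by (intro step_eq) auto
    also have "w \<notin> p ` {2 * Suc m + 1..<L}" using step.prems by auto
    then have "N (p (2 * m + 1 + 2)) w = common_wt" using step by simp
    finally show ?case .
  qed
qed

text \<open>A vertex off the cycle sees all of \<open>p 1, \<dots>, p (L - 1)\<close> with weight \<open>common_wt\<close>, which would make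
  this set separable.\<close>

lemma cycle_spans:
  assumes L: "L = 2 * K + 1"
  shows "V = p ` {..<L}"
proof (rule ccontr)
  assume "V \<noteq> p ` {..<L}"
  then obtain w where w: "w \<in> V" "w \<notin> p ` {..<L}" using p_V by blast
  let ?X = "p ` {1..<L}"
  have row: "N (p i) y = common_wt" if "1 \<le> i" "i < L" "y \<in> V" "y \<notin> p ` {..<L}" for i y
  proof (cases "even i")
    case True
    then obtain k where k: "i = 2 * k" by (auto elim: evenE)
    then have "p ` {..2 * k} \<subseteq> p ` {..<L}" using that by (intro image_mono) auto
    then show ?thesis using even_row[of k y] that k by auto
  next
    case False
    then obtain k where k: "i = 2 * k + 1" by (auto elim: oddE)
    have "p ` {2 * k + 1..<L} \<subseteq> p ` {..<L}" "p 0 \<in> p ` {..<L}" using L5 by auto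
    then show ?thesis using odd_row[OF L, of k y] that k L by auto
  qed
  have "?X \<subseteq> V" "p 0 \<in> V - ?X" "w \<in> V - ?X" "p 0 \<noteq> w" using w p_V p_eq L5 by auto
  have "N x y = N x' y" if "x \<in> ?X" "x' \<in> ?X" "y \<in> V - ?X" for x x' y
  proof (cases "y = p 0")
    case True
    then show ?thesis using N_base that p_V by auto
  next
    case False
    have "y \<notin> p ` {..<L}"
    proof
      assume "y \<in> p ` {..<L}"
      then obtain j where "j < L" "y = p j" by blast
      then show False using False that(3) by (cases j) auto
    qed
    then show ?thesis using row that by auto
  qed
  then have "S ?X (V - ?X)" using S_iff[of ?X "V - ?X"] \<open>?X \<subseteq> V\<close> \<open>p 0 \<in> V - ?X\<close> by blast
  then have "card ?X \<le> 1" using separated_small \<open>?X \<subseteq> V\<close> \<open>p 0 \<in> V - ?X\<close> \<open>w \<in> V - ?X\<close> \<open>p 0 \<noteq> w\<close> by blast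
  moreover have "2 \<le> card ?X" by (rule two_elements[of _ "p 1" "p 2"]) (use L5 p_eq in auto)
  ultimately show False by simp
qed

lemma half_graph_structure:
  obtains K \<gamma> \<delta> where "2 \<le> K" "L = 2 * K + 1" "V = p ` {..<L}" "\<delta> \<noteq> \<gamma>"
    "\<And>l m. l \<in> {1..K} \<Longrightarrow> m \<in> {1..K} \<Longrightarrow> l \<noteq> m \<Longrightarrow> N (p (2 * l)) (p (2 * m)) = \<gamma>"
    "\<And>l m. l \<in> {1..K} \<Longrightarrow> m \<in> {1..K} \<Longrightarrow> l \<noteq> m \<Longrightarrow> N (p (2 * l - 1)) (p (2 * m - 1)) = \<gamma>"
    "\<And>l m. l \<in> {1..K} \<Longrightarrow> m \<in> {1..K} \<Longrightarrow> N (p (2 * l)) (p (2 * m - 1)) = (if l < m then \<gamma> else \<delta>)"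
proof -
  obtain K where L: "L = 2 * K + 1" using odd_L by (auto elim: oddE)
  have K: "2 \<le> K" using L L5 by simp
  have even: "N (p (2 * l)) (p j) = common_wt" if "l \<in> {1..K}" "2 * l < j" "j < L" for l j
    using that L p_V p_eq by (intro even_row) (auto simp: image_iff)
  have odd: "N (p (2 * m - 1)) (p j) = common_wt" if "m \<in> {1..K}" "1 \<le> j" "j < 2 * m - 1" for m j
  proof -
    have "2 * m - 1 = 2 * (m - 1) + 1" using that by auto
    moreover have "N (p (2 * (m - 1) + 1)) (p j) = common_wt"
      using that L p_V p_eq by (intro odd_row[OF L]) (auto simp: image_iff)
    ultimately show ?thesis by simp
  qed
  have sym: "N (p i) (p j) = N (p j) (p i)" if "i < L" "j < L" for i j
    using N_sym p_V that by blast
  show thesis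
  proof (rule that[OF K L cycle_spans[OF L] second_row(2)])
    show "N (p (2 * l)) (p (2 * m)) = common_wt" if "l \<in> {1..K}" "m \<in> {1..K}" "l \<noteq> m" for l m
      using even[of l "2 * m"] even[of m "2 * l"] sym[of "2 * l" "2 * m"] that L by (cases "l < m") auto
    show "N (p (2 * l - 1)) (p (2 * m - 1)) = common_wt" if "l \<in> {1..K}" "m \<in> {1..K}" "l \<noteq> m" for l m
      using odd[of l "2 * m - 1"] odd[of m "2 * l - 1"] sym[of "2 * l - 1" "2 * m - 1"] that L
      by (cases "l < m") auto
    show "N (p (2 * l)) (p (2 * m - 1)) = (if l < m then common_wt else flipped_wt)"
      if "l \<in> {1..K}" "m \<in> {1..K}" for l m
    proof (cases "l < m")
      case True
      then show ?thesis using even[of l "2 * m - 1"] that L by auto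
    next
      case False
      have "2 * m - 1 = 2 * (m - 1) + 1" using that by auto
      then show ?thesis using even_row_below[of l "m - 1"] False that L by auto
    qed
  qed
qed

end
end

section \<open>Separability by second differences\<close>

text \<open>The vanishing of all second differences modulo \<open>q\<close> says that the weights between \<open>X\<close> and \<open>Y\<close> have
  the form \<open>f x + g y\<close>.  Unlike the existence of a switching, this form needs no choice of labels, and
  it can be checked one quadruple at a time.\<close>

definition uncrossed :: "nat \<Rightarrow> 'v wgraph \<Rightarrow> 'v set \<Rightarrow> 'v set \<Rightarrow> bool" where
  "uncrossed q G X Y \<longleftrightarrow> X \<subseteq> verts G \<and> Y \<subseteq> verts G \<and>
    (\<forall>x\<in>X. \<forall>x'\<in>X. \<forall>y\<in>Y. \<forall>y'\<in>Y.
      int q dvd int (wt G x y) - int (wt G x' y) - int (wt G x y') + int (wt G x' y'))"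

lemma uncrossedD:
  assumes "uncrossed q G X Y" "x \<in> X" "x' \<in> X" "y \<in> Y" "y' \<in> Y"
  shows "int q dvd int (wt G x y) - int (wt G x' y) - int (wt G x y') + int (wt G x' y')"
  using assms unfolding uncrossed_def by blast

lemma split_relation_uncrossed:
  assumes G: "wgraph q G"
  shows "split_relation (verts G) (uncrossed q G)"
proof
  show "finite (verts G)" using G unfolding wgraph_def by blast
  show "uncrossed q G Y X" if "uncrossed q G X Y" for X Y
    unfolding uncrossed_def
  proof (intro conjI ballI)
    show sub: "Y \<subseteq> verts G" "X \<subseteq> verts G" using that unfolding uncrossed_def by auto
    fix y y' x x' assume h: "y \<in> Y" "y' \<in> Y" "x \<in> X" "x' \<in> X"
    then have "wt G y x = wt G x y" "wt G y' x = wt G x y'" "wt G y x' = wt G x' y" "wt G y' x' = wt G x' y'"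
      using G sub unfolding wgraph_def by (meson subsetD)+
    then show "int q dvd int (wt G y x) - int (wt G y' x) - int (wt G y x') + int (wt G y' x')"
      using uncrossedD[OF that h(3,4,1,2)] by (simp add: algebra_simps)
  qed
  show "uncrossed q G X' Y'" if "uncrossed q G X Y" "X' \<subseteq> X" "Y' \<subseteq> Y" for X Y X' Y'
    using that unfolding uncrossed_def by (meson subset_iff)
  show "uncrossed q G X (B \<union> D)"
    if B: "uncrossed q G X B" and D: "uncrossed q G X D" and meet: "B \<inter> D \<noteq> {}" for X B D
    unfolding uncrossed_def
  proof (intro conjI ballI)
    show "X \<subseteq> verts G" "B \<union> D \<subseteq> verts G" using B D unfolding uncrossed_def by auto
    obtain z where z: "z \<in> B" "z \<in> D" using meet by blast
    fix x x' y y' assume x: "x \<in> X" "x' \<in> X" and y: "y \<in> B \<union> D" "y' \<in> B \<union> D"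
    have to_z: "int q dvd int (wt G x w) - int (wt G x' w) - int (wt G x z) + int (wt G x' z)"
      if "w \<in> B \<union> D" for w
      using that uncrossedD[OF B x _ z(1)] uncrossedD[OF D x _ z(2)] by blast
    show "int q dvd int (wt G x y) - int (wt G x' y) - int (wt G x y') + int (wt G x' y')"
      using dvd_diff[OF to_z[OF y(1)] to_z[OF y(2)]] by (simp add: algebra_simps)
  qed
qed

lemma separable_set_imp_uncrossed:
  assumes "separable_set q G W"
  shows "uncrossed q G W (verts G - W)"
  unfolding uncrossed_def
proof (intro conjI ballI)
  show W: "W \<subseteq> verts G" using assms unfolding separable_set_def by blast
  show "verts G - W \<subseteq> verts G" by blast
  obtain A f where A: "verts A = verts G"
      "\<forall>v\<in>verts A. \<forall>w\<in>verts A. v \<noteq> w \<longrightarrow> wt A v w = (f v + f w) mod q"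
      "\<forall>v\<in>W. \<forall>w\<in>verts G - W. wt (graph_sum q G A) v w = 0"
    using assms unfolding separable_set_def is_switching_def additive_def by blast
  have zero: "int q dvd int (wt G v w) + int (f v) + int (f w)" if "v \<in> W" "w \<in> verts G - W" for v w
  proof -
    have "(wt G v w + (f v + f w) mod q) mod q = 0"
    proof -
      have "v \<in> verts A" "w \<in> verts A" "v \<noteq> w" using that W A(1) by auto
      then have "wt A v w = (f v + f w) mod q" using A(2) by blast
      moreover have "(wt G v w + wt A v w) mod q = 0" using A(3) that unfolding graph_sum_def by simp
      ultimately show ?thesis by simp
    qed
    then have "(wt G v w + (f v + f w)) mod q = 0" by (simp only: mod_add_right_eq)
    then have "q dvd wt G v w + f v + f w" by (auto simp: algebra_simps)
    then show ?thesis by (metis int_dvd_int_iff of_nat_add)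
  qed
  fix x x' y y' assume "x \<in> W" "x' \<in> W" "y \<in> verts G - W" "y' \<in> verts G - W"
  then show "int q dvd int (wt G x y) - int (wt G x' y) - int (wt G x y') + int (wt G x' y')"
    using dvd_diff[OF dvd_diff[OF zero[of x y] zero[of x' y]] dvd_diff[OF zero[of x y'] zero[of x' y']]]
    by (simp add: algebra_simps)
qed

definition additive_graph :: "nat \<Rightarrow> 'v set \<Rightarrow> ('v \<Rightarrow> nat) \<Rightarrow> 'v wgraph" where
  "additive_graph q V f = \<lparr>verts = V, wt = (\<lambda>v w. if v = w then 0 else (f v + f w) mod q)\<rparr>"

lemma additive_additive_graph:
  assumes "0 < q" "finite V" "\<And>v. v \<in> V \<Longrightarrow> f v < q"
  shows "additive q (additive_graph q V f)"
  unfolding additive_def wgraph_def additive_graph_def using assms by (auto simp: add.commute)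

text \<open>If both sides are nonempty, fix \<open>x0\<close> and \<open>y0\<close>: the labels outside \<open>W\<close> cancel the row of \<open>x0\<close>, and those
  inside cancel the difference to \<open>x0\<close> in the column of \<open>y0\<close>.\<close>

lemma uncrossed_imp_separable_set:
  assumes G: "wgraph q G" and q: "0 < q" and un: "uncrossed q G W (verts G - W)"
  shows "separable_set q G W"
proof -
  have W: "W \<subseteq> verts G" using un unfolding uncrossed_def by blast
  have "\<exists>f::'a \<Rightarrow> int. \<forall>v\<in>W. \<forall>w\<in>verts G - W. int q dvd int (wt G v w) + f v + f w"
  proof (cases "W = {} \<or> verts G - W = {}")
    case True
    then show ?thesis by blast
  next
    case False
    then obtain x0 y0 where x0: "x0 \<in> W" and y0: "y0 \<in> verts G - W" by blast
    let ?f = "\<lambda>v. if v \<in> W then int (wt G x0 y0) - int (wt G v y0) else - int (wt G x0 v)"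
    have "int q dvd int (wt G v w) + ?f v + ?f w" if "v \<in> W" "w \<in> verts G - W" for v w
      using uncrossedD[OF un that(1) x0 that(2) y0] that by (simp add: algebra_simps)
    then show ?thesis by (intro exI[of _ ?f] ballI)
  qed
  then obtain f :: "'a \<Rightarrow> int" where
    f: "\<And>v w. v \<in> W \<Longrightarrow> w \<in> verts G - W \<Longrightarrow> int q dvd int (wt G v w) + f v + f w" by blast
  define g where "g v = nat (f v mod int q)" for v
  have g: "int (g v) = f v mod int q" for v using q unfolding g_def by simp
  have "g v < q" for v using q unfolding g_def by (simp add: nat_less_iff)
  then have "additive q (additive_graph q (verts G) g)"
    using additive_additive_graph q G unfolding wgraph_def by metis
  moreover have "wt (graph_sum q G (additive_graph q (verts G) g)) v w = 0"
    if vw: "v \<in> W" "w \<in> verts G - W" for v w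
  proof -
    have "int ((wt G v w + (g v + g w)) mod q) = (int (wt G v w) + (f v mod int q + f w mod int q)) mod int q"
      by (simp add: g zmod_int)
    also have "\<dots> = (int (wt G v w) + f v + f w) mod int q" by (metis mod_add_eq mod_add_right_eq add.assoc)
    also have "\<dots> = 0" using f[OF vw] by (simp add: dvd_eq_mod_eq_0)
    finally have "(wt G v w + (g v + g w)) mod q = 0" by simp
    moreover have "v \<noteq> w" using vw by blast
    ultimately show ?thesis unfolding graph_sum_def additive_graph_def by (simp add: mod_add_right_eq)
  qed
  moreover have "verts (additive_graph q (verts G) g) = verts G" unfolding additive_graph_def by simp
  ultimately show ?thesis using W unfolding separable_set_def is_switching_def by blast
qed

lemma critical_split_relation_uncrossed:
  assumes G: "wgraph q G" and q: "0 < q" and ne: "verts G \<noteq> {}" and nonsep: "\<not> separable q G"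
    and del: "\<And>v. v \<in> verts G \<Longrightarrow> separable q (del_vertex G v)"
  shows "critical_split_relation (verts G) (uncrossed q G)"
proof -
  interpret split_relation "verts G" "uncrossed q G" using split_relation_uncrossed[OF G] .
  show ?thesis
  proof
    show "verts G \<noteq> {}" by fact
    show "card X \<le> 1 \<or> card (verts G - X) \<le> 1"
      if X: "X \<subseteq> verts G" and un: "uncrossed q G X (verts G - X)" for X
    proof -
      have "card X \<in> {0, 1, card (verts G) - 1, card (verts G)}"
        using uncrossed_imp_separable_set[OF G q un] nonsep
        unfolding separable_def nontrivial_separable_set_def by blast
      moreover have "card (verts G - X) = card (verts G) - card X"
        using X finite_V by (simp add: card_Diff_subset finite_subset)
      ultimately show ?thesis by auto
    qed
    show "\<exists>A B. split v A B" if v: "v \<in> verts G" for v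
    proof -
      let ?D = "del_vertex G v"
      have D: "verts ?D = verts G - {v}" "wt ?D = wt G"
        unfolding del_vertex_def subgraph_on_def by auto
      obtain W where W: "separable_set q ?D W" "card W \<notin> {0, 1, card (verts ?D) - 1, card (verts ?D)}"
        using del[OF v] unfolding separable_def nontrivial_separable_set_def by blast
      have sub: "W \<subseteq> verts G - {v}" using W(1) D unfolding separable_set_def by simp
      have "uncrossed q ?D W (verts G - {v} - W)" using separable_set_imp_uncrossed[OF W(1)] D by simp
      then have "uncrossed q G W (verts G - {v} - W)" unfolding uncrossed_def D by blast
      moreover have "card (verts G - {v} - W) = card (verts ?D) - card W"
        using sub finite_V D by (simp add: card_Diff_subset finite_subset)
      moreover have "card W \<le> card (verts ?D)" using sub finite_V D by (simp add: card_mono)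
      ultimately have "split v W (verts G - {v} - W)"
        unfolding split_def using v sub W(2) by auto
      then show ?thesis by blast
    qed
  qed
qed

section \<open>Recognising the exceptional graph\<close>

text \<open>The weights of the switching that isolates \<open>z\<close>, with the labels \<open>- wt G z v\<close>.  The values on the
  diagonal are not weights of that switching.\<close>

definition isolating_wt :: "nat \<Rightarrow> 'v wgraph \<Rightarrow> 'v \<Rightarrow> 'v \<Rightarrow> 'v \<Rightarrow> int" where
  "isolating_wt q G z v w = (int (wt G v w) - int (wt G z v) - int (wt G z w)) mod int q"

lemma isolating_wt_dvd:
  "int q dvd int (wt G v w) - int (wt G z v) - int (wt G z w) - isolating_wt q G z v w"
  unfolding isolating_wt_def by (rule dvd_minus_mod)

lemma isolating_wt_commute:
  assumes "wgraph q G" "v \<in> verts G" "w \<in> verts G"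
  shows "isolating_wt q G z v w = isolating_wt q G z w v"
proof -
  have "wt G v w = wt G w v" using assms unfolding wgraph_def by blast
  then show ?thesis unfolding isolating_wt_def by (simp add: algebra_simps)
qed

lemma isolating_wt_isolated:
  assumes "wgraph q G" "z \<in> verts G" "v \<in> verts G"
  shows "isolating_wt q G z z v = 0" "isolating_wt q G z v z = 0"
proof -
  have "wt G z z = 0" "wt G z v = wt G v z" using assms unfolding wgraph_def by auto
  then show "isolating_wt q G z z v = 0" "isolating_wt q G z v z = 0" unfolding isolating_wt_def by auto
qed

text \<open>Second differences do not change under switching, and those that involve the isolated
  vertex \<open>z\<close> are plain differences of weights.\<close>

lemma uncrossed_iff_homogeneous:
  assumes G: "wgraph q G" and sub: "X \<subseteq> verts G" "Y \<subseteq> verts G" and z: "z \<in> Y"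
  shows "uncrossed q G X Y \<longleftrightarrow>
    (\<forall>x\<in>X. \<forall>x'\<in>X. \<forall>y\<in>Y. isolating_wt q G z x y = isolating_wt q G z x' y)"
proof -
  have eq: "isolating_wt q G z x y = isolating_wt q G z x' y \<longleftrightarrow>
      int q dvd int (wt G x y) - int (wt G x' y) - int (wt G x z) + int (wt G x' z)"
    if "x \<in> X" "x' \<in> X" for x x' y
  proof -
    have "wt G z x = wt G x z" "wt G z x' = wt G x' z"
      using G sub z that unfolding wgraph_def by auto
    then show ?thesis unfolding isolating_wt_def mod_eq_dvd_iff by (simp add: algebra_simps)
  qed
  show ?thesis
  proof
    assume "uncrossed q G X Y"
    then show "\<forall>x\<in>X. \<forall>x'\<in>X. \<forall>y\<in>Y. isolating_wt q G z x y = isolating_wt q G z x' y"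
      using eq z uncrossedD by meson
  next
    assume hom: "\<forall>x\<in>X. \<forall>x'\<in>X. \<forall>y\<in>Y. isolating_wt q G z x y = isolating_wt q G z x' y"
    show "uncrossed q G X Y"
      unfolding uncrossed_def
    proof (intro conjI ballI sub)
      fix x x' y y' assume x: "x \<in> X" "x' \<in> X" and y: "y \<in> Y" "y' \<in> Y"
      have *: "int q dvd int (wt G x w) - int (wt G x' w) - int (wt G x z) + int (wt G x' z)" if "w \<in> Y" for w
        using hom eq[OF x] x that by blast
      show "int q dvd int (wt G x y) - int (wt G x' y) - int (wt G x y') + int (wt G x' y')"
        using dvd_diff[OF *[OF y(1)] *[OF y(2)]] by (simp add: algebra_simps)
    qed
  qed
qed

lemma half_of_modulus:
  fixes \<gamma> \<delta> :: int
  assumes "0 \<le> \<gamma>" "\<gamma> < int q" "0 \<le> \<delta>" "\<delta> < int q" "\<delta> \<noteq> \<gamma>" "int q dvd 2 * (\<delta> - \<gamma>)"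
  shows "even q" "\<delta> = (\<gamma> + int (q div 2)) mod int q"
proof -
  obtain c where c: "2 * (\<delta> - \<gamma>) = int q * c" using assms(6) by (auto elim: dvdE)
  have "\<bar>\<delta> - \<gamma>\<bar> < int q" using assms(1-4) by auto
  moreover have "2 * \<bar>\<delta> - \<gamma>\<bar> = int q * \<bar>c\<bar>"
    using arg_cong[OF c, of abs] by (simp only: abs_mult abs_numeral abs_of_nat)
  ultimately have "int q * \<bar>c\<bar> < int q * 2" by (metis mult.commute mult_strict_left_mono zero_less_numeral)
  then have "\<bar>c\<bar> < 2" using assms(1,2) by (simp add: mult_less_cancel_left)
  moreover have "c \<noteq> 0" using c assms(5) by auto
  ultimately have "c = 1 \<or> c = -1" by linarith
  then have 2: "2 * (\<delta> - \<gamma>) = int q \<or> 2 * (\<gamma> - \<delta>) = int q" using c by auto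
  then have "even (int q)" by (metis dvd_triv_left)
  then show "even q" by simp
  then have h: "2 * int (q div 2) = int q" by (metis dvd_mult_div_cancel of_nat_mult of_nat_numeral)
  show "\<delta> = (\<gamma> + int (q div 2)) mod int q"
  proof (cases "2 * (\<delta> - \<gamma>) = int q")
    case True
    then have "\<gamma> + int (q div 2) = \<delta>" using h by presburger
    then show ?thesis using assms(3,4) by simp
  next
    case False
    then have "\<gamma> + int (q div 2) = \<delta> + int q" using h 2 by presburger
    then show ?thesis using assms(3,4) by simp
  qed
qed

text \<open>Even positions on the cycle become \<open>a\<^sub>0, a\<^sub>1, \<dots>\<close> and odd positions \<open>b\<^sub>1, b\<^sub>2, \<dots>\<close>, so that
  \<open>a\<^sub>l\<close> precedes \<open>b\<^sub>m\<close> on the path exactly if \<open>l < m\<close>.\<close>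

definition ab_label :: "nat \<Rightarrow> ab_vertex" where
  "ab_label i = (if even i then VA (i div 2) else VB ((i + 1) div 2))"

lemma bij_betw_ab_label:
  "bij_betw ab_label {..<2 * K + 1} (VA ` {0..K} \<union> VB ` {1..K})"
proof (rule bij_betw_imageI)
  show "inj_on ab_label {..<2 * K + 1}"
    by (auto simp: inj_on_def ab_label_def elim!: evenE oddE split: if_splits)
  show "ab_label ` {..<2 * K + 1} = VA ` {0..K} \<union> VB ` {1..K}"
  proof (intro equalityI subsetI)
    fix a assume "a \<in> ab_label ` {..<2 * K + 1}"
    then show "a \<in> VA ` {0..K} \<union> VB ` {1..K}" by (auto simp: ab_label_def elim!: evenE oddE)
  next
    fix a assume "a \<in> VA ` {0..K} \<union> VB ` {1..K}"
    then consider l where "a = VA l" "l \<le> K" | m where "a = VB m" "1 \<le> m" "m \<le> K" by auto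
    then show "a \<in> ab_label ` {..<2 * K + 1}"
    proof cases
      case 1
      then show ?thesis by (intro image_eqI[of _ _ "2 * l"]) (auto simp: ab_label_def)
    next
      case 2
      then show ?thesis by (intro image_eqI[of _ _ "2 * m - 1"]) (auto simp: ab_label_def)
    qed
  qed
qed

text \<open>Switching can be undone: adding the labels \<open>wt G z v\<close> to a copy of the graph in which \<open>z\<close> has
  been isolated restores the original weights.\<close>

lemma isolating_wt_switching:
  assumes q: "0 < q" and G: "wgraph q G" and z: "z \<in> verts G" and H: "finite (verts H)"
    and diag: "\<And>a. a \<in> verts H \<Longrightarrow> wt H a a = 0"
    and bij: "bij_betw \<phi> (verts G) (verts H)"
    and wt: "\<And>v w. v \<in> verts G \<Longrightarrow> w \<in> verts G \<Longrightarrow> v \<noteq> w \<Longrightarrow>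
      int (wt H (\<phi> v) (\<phi> w)) = isolating_wt q G z v w"
  shows "\<exists>H'. is_switching q H' H \<and> isomorphic G H'"
proof -
  define g where "g a = wt G z (inv_into (verts G) \<phi> a)" for a
  have g: "g (\<phi> v) = wt G z v" if "v \<in> verts G" for v
    using that bij unfolding g_def bij_betw_def by (simp add: inv_into_f_f)
  have "g a < q" if "a \<in> verts H" for a
  proof -
    have "a \<in> \<phi> ` verts G" using that bij_betw_imp_surj_on[OF bij] by simp
    then obtain v where "v \<in> verts G" "a = \<phi> v" by blast
    then show ?thesis using g G z unfolding wgraph_def by simp
  qed
  then have add: "additive q (additive_graph q (verts H) g)" using additive_additive_graph[OF q H] by blast
  let ?H' = "graph_sum q H (additive_graph q (verts H) g)"
  have "is_switching q ?H' H" using add unfolding is_switching_def additive_graph_def by auto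
  moreover have "wt ?H' (\<phi> v) (\<phi> w) = wt G v w" if vw: "v \<in> verts G" "w \<in> verts G" for v w
  proof (cases "v = w")
    case True
    have "\<phi> v \<in> verts H" using bij_betwE[OF bij] vw by blast
    then show ?thesis using True diag G vw unfolding graph_sum_def additive_graph_def wgraph_def by simp
  next
    case False
    then have "\<phi> v \<noteq> \<phi> w" using inj_onD[OF bij_betw_imp_inj_on[OF bij]] vw by blast
    then have "wt ?H' (\<phi> v) (\<phi> w) = (wt H (\<phi> v) (\<phi> w) + (wt G z v + wt G z w)) mod q"
      unfolding graph_sum_def additive_graph_def using g vw by (simp add: mod_add_right_eq)
    then have "int (wt ?H' (\<phi> v) (\<phi> w)) =
        (isolating_wt q G z v w + (int (wt G z v) + int (wt G z w))) mod int q"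
      using wt[OF vw False] by (simp add: zmod_int)
    also have "\<dots> = int (wt G v w) mod int q"
      unfolding isolating_wt_def by (simp add: mod_simps)
    also have "\<dots> = int (wt G v w)" using G vw unfolding wgraph_def by (simp flip: zmod_int)
    finally show ?thesis by simp
  qed
  moreover have "verts ?H' = verts H" unfolding graph_sum_def by simp
  ultimately show ?thesis using bij unfolding isomorphic_def by metis
qed

text \<open>The one twin relation that the half-graph structure has not yet exploited is that of \<open>p 1\<close> and
  \<open>p (2 * K)\<close> in \<open>G - p 0\<close>.  Its second difference at \<open>p 2\<close> and \<open>p 3\<close> is \<open>2 * (\<delta> - \<gamma>)\<close>, and this is how
  \<open>q / 2\<close> arises.\<close>

lemma critical_imp_exceptional:
  assumes q: "0 < q" and G: "wgraph q G" and crit: "critical_split_relation (verts G) (uncrossed q G)"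
  obtains \<gamma> H where "even q" "odd (card (verts G))" "5 \<le> card (verts G)" "\<gamma> < q"
    "is_switching q H (exceptional_graph q (card (verts G)) \<gamma>)" "isomorphic G H"
proof -
  interpret critical_split_relation "verts G" "uncrossed q G" using crit .
  obtain p L where cyc: "twin_cycle p L" using exists_twin_cycle by blast
  note pV = twin_cycle_in_V[OF cyc]
  let ?N = "isolating_wt q G (p 0)"
  have base: "p 0 \<in> verts G" using pV[of 0] cyc unfolding twin_cycle_def by simp
  obtain K \<gamma> \<delta> where K: "2 \<le> K" and L: "L = 2 * K + 1" and V: "verts G = p ` {..<L}" and ne: "\<delta> \<noteq> \<gamma>"
    and AA: "\<And>l m. l \<in> {1..K} \<Longrightarrow> m \<in> {1..K} \<Longrightarrow> l \<noteq> m \<Longrightarrow> ?N (p (2 * l)) (p (2 * m)) = \<gamma>"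
    and BB: "\<And>l m. l \<in> {1..K} \<Longrightarrow> m \<in> {1..K} \<Longrightarrow> l \<noteq> m \<Longrightarrow> ?N (p (2 * l - 1)) (p (2 * m - 1)) = \<gamma>"
    and AB: "\<And>l m. l \<in> {1..K} \<Longrightarrow> m \<in> {1..K} \<Longrightarrow> ?N (p (2 * l)) (p (2 * m - 1)) = (if l < m then \<gamma> else \<delta>)"
  proof (rule half_graph_structure[OF cyc, of ?N])
    show "?N x y = ?N y x" if "x \<in> verts G" "y \<in> verts G" for x y
      using isolating_wt_commute[OF G that] .
    show "?N x (p 0) = ?N y (p 0)" if "x \<in> verts G" "y \<in> verts G" for x y
      using isolating_wt_isolated(2)[OF G base] that by simp
    show "uncrossed q G X Y \<longleftrightarrow> (\<forall>x\<in>X. \<forall>x'\<in>X. \<forall>y\<in>Y. ?N x y = ?N x' y)"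
      if "X \<subseteq> verts G" "Y \<subseteq> verts G" "X \<inter> Y = {}" "p 0 \<in> Y" for X Y
      using uncrossed_iff_homogeneous[OF G that(1,2,4)] .
  qed blast
  have sym: "?N (p i) (p j) = ?N (p j) (p i)" if "i < L" "j < L" for i j
    using isolating_wt_commute[OF G] pV that by blast
  have inj: "inj_on p {..<L}" using cyc unfolding twin_cycle_def by blast
  have n: "card (verts G) = 2 * K + 1" using V L card_image[OF inj] by simp
  have range: "0 \<le> ?N v w" "?N v w < int q" for v w using q unfolding isolating_wt_def by auto
  have \<gamma>: "0 \<le> \<gamma>" "\<gamma> < int q" using range AA[of 1 2] K by auto
  have \<delta>: "0 \<le> \<delta>" "\<delta> < int q" using range AB[of 1 1] K by (metis atLeastAtMost_iff le_trans less_irrefl one_le_numeral order_refl)+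
  have "twins (p 0) (p (2 * K)) (p 1)" using cyc L unfolding twin_cycle_def by simp
  then have "uncrossed q G {p (2 * K), p 1} (verts G - {p 0, p (2 * K), p 1})"
    unfolding twins_def split_def by blast
  moreover have "p i \<in> verts G - {p 0, p (2 * K), p 1}" if "i = 2 \<or> i = 3" for i
    using that pV K L inj_on_eq_iff[OF inj] by auto
  ultimately have cross: "int q dvd int (wt G (p 1) (p 2)) - int (wt G (p (2 * K)) (p 2))
      - int (wt G (p 1) (p 3)) + int (wt G (p (2 * K)) (p 3))"
    by (blast intro: uncrossedD)
  have vals: "?N (p 1) (p 2) = \<delta>" "?N (p (2 * K)) (p 2) = \<gamma>" "?N (p 1) (p 3) = \<gamma>"
      "?N (p (2 * K)) (p 3) = \<delta>"
    using sym[of 1 2] AB[of 1 1] AA[of K 1] BB[of 1 2] AB[of K 2] K L by auto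
  have dvd: "int q dvd int (wt G v w) - int (wt G (p 0) v) - int (wt G (p 0) w) - ?N v w" for v w
    by (rule isolating_wt_dvd)
  have "int q dvd 2 * (\<delta> - \<gamma>)"
    using dvd_diff[OF cross dvd_diff[OF dvd_diff[OF dvd[of "p 1" "p 2"] dvd[of "p (2 * K)" "p 2"]]
      dvd_diff[OF dvd[of "p 1" "p 3"] dvd[of "p (2 * K)" "p 3"]]]]
    unfolding vals by (simp add: algebra_simps)
  note half = half_of_modulus[OF \<gamma> \<delta> ne this]
  let ?X = "exceptional_graph q (card (verts G)) (nat \<gamma>)"
  have vX: "verts ?X = VA ` {0..K} \<union> VB ` {1..K}" and wX: "wt ?X = exceptional_wt q (nat \<gamma>)"
    unfolding exceptional_graph_def n by simp_all
  have nat: "int ((nat \<gamma> + q div 2) mod q) = \<delta>" using half(2) \<gamma> by (simp add: zmod_int)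
  let ?\<phi> = "ab_label \<circ> inv_into {..<L} p"
  have "bij_betw (inv_into {..<L} p) (verts G) {..<L}"
    using inj V bij_betw_inv_into[of p "{..<L}" "verts G"] by (simp add: bij_betw_def)
  then have bij: "bij_betw ?\<phi> (verts G) (verts ?X)"
    using bij_betw_trans bij_betw_ab_label[of K] vX L by metis
  have lab: "?\<phi> (p i) = ab_label i" if "i < L" for i using inj that by simp
  have wts: "int (exceptional_wt q (nat \<gamma>) (ab_label i) (ab_label j)) = ?N (p i) (p j)"
    if "i < L" "j < L" "i \<noteq> j" for i j
  proof -
    have idx: "(\<exists>l\<in>{1..K}. i = 2 * l \<and> ab_label i = VA l) \<or> (\<exists>m\<in>{1..K}. i = 2 * m - 1 \<and> ab_label i = VB m)"
      if "i < L" "i \<noteq> 0" for i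
    proof (cases "even i")
      case True
      then show ?thesis using that L by (auto simp: ab_label_def elim!: evenE)
    next
      case False
      then obtain m where "i = 2 * m + 1" by (auto elim: oddE)
      then have "Suc m \<in> {1..K}" "i = 2 * Suc m - 1" "ab_label i = VB (Suc m)"
        using that L by (auto simp: ab_label_def)
      then show ?thesis by blast
    qed
    have 0: "ab_label 0 = VA 0" by (simp add: ab_label_def)
    show ?thesis
    proof (cases "i = 0 \<or> j = 0")
      case True
      have "exceptional_wt q (nat \<gamma>) (VA 0) a = 0" "exceptional_wt q (nat \<gamma>) a (VA 0) = 0" for a
        by (cases a; simp)+
      then show ?thesis using True 0 isolating_wt_isolated[OF G base] pV that by auto
    next
      case False
      then have "i \<noteq> 0" "j \<noteq> 0" by auto
      note ij = that \<gamma> nat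
      from idx[OF that(1) \<open>i \<noteq> 0\<close>] idx[OF that(2) \<open>j \<noteq> 0\<close>] show ?thesis
      proof (elim disjE bexE conjE)
        fix l m assume h: "l \<in> {1..K}" "m \<in> {1..K}" and i: "i = 2 * l" "ab_label i = VA l"
          and j: "j = 2 * m" "ab_label j = VA m"
        then show ?thesis using AA[OF h] ij by auto
      next
        fix l m assume h: "l \<in> {1..K}" "m \<in> {1..K}" and i: "i = 2 * l" "ab_label i = VA l"
          and j: "j = 2 * m - 1" "ab_label j = VB m"
        then show ?thesis using AB[OF h] ij by auto
      next
        fix m l assume h: "m \<in> {1..K}" "l \<in> {1..K}" and i: "i = 2 * m - 1" "ab_label i = VB m"
          and j: "j = 2 * l" "ab_label j = VA l"
        then show ?thesis using AB[OF h(2,1)] sym[OF that(1,2)] ij by auto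
      next
        fix l m assume h: "l \<in> {1..K}" "m \<in> {1..K}" and i: "i = 2 * l - 1" "ab_label i = VB l"
          and j: "j = 2 * m - 1" "ab_label j = VB m"
        then show ?thesis using BB[OF h] ij by auto
      qed
    qed
  qed
  have "int (wt ?X (?\<phi> v) (?\<phi> w)) = ?N v w" if "v \<in> verts G" "w \<in> verts G" "v \<noteq> w" for v w
  proof -
    have "v \<in> p ` {..<L}" "w \<in> p ` {..<L}" using that unfolding V by auto
    then obtain i j where "v = p i" "w = p j" "i < L" "j < L" by blast
    moreover have "i \<noteq> j" using calculation that(3) by blast
    ultimately show ?thesis using lab wts wX by simp
  qed
  moreover have "finite (verts ?X)" using vX by simp
  moreover have "wt ?X a a = 0" if "a \<in> verts ?X" for a using wX by (cases a) auto
  ultimately obtain H where "is_switching q H ?X" "isomorphic G H"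
    using isolating_wt_switching[OF q G base _ _ bij] by blast
  then show thesis using that[of "nat \<gamma>" H] half(1) n K \<gamma> by (simp add: nat_less_iff)
qed

theorem mainTheorem1:
  fixes q n :: nat and G :: "'v wgraph"
  assumes "q \<ge> 2"
    and "wgraph q G"
    and "graph_order G = n"
    and "n \<ge> 1"
    and "\<And>v. v \<in> verts G \<Longrightarrow> separable q (del_vertex G v)"
  shows "separable q G \<or>
    (even q \<and> odd n \<and> n \<ge> 5 \<and>
      (\<exists>\<gamma> H. \<gamma> < q \<and> is_switching q H (exceptional_graph q n \<gamma>) \<and> isomorphic G H))"
proof (cases "separable q G")
  case False
  have q: "0 < q" using assms(1) by simp
  have n: "card (verts G) = n" using assms(3) unfolding graph_order_def .
  have "verts G \<noteq> {}" using n assms(4) by auto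
  then have "critical_split_relation (verts G) (uncrossed q G)"
    using critical_split_relation_uncrossed[OF assms(2) q _ False] assms(5) by blast
  then show ?thesis using critical_imp_exceptional[OF q assms(2)] n by metis
qed blast

end
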